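(* Let $d\ge1$, let $\alpha_T$ be the automorphism of $C(\mathbb T^d)$ induced by $T\in GL_d(\mathbb Z)$, and let $\beta_T$ be the automorphism of $C^*_r(\mathbb Z^d)$ associated to $\alpha_T$ (via the Fourier transform $C^*_r(\mathbb Z^d)\cong C(\mathbb T^d)$). Then for all natural numbers $k>d$, $$\mathrm{Entp}_{L^k_\ell}(\beta_T)=\sum_{|\lambda_i|>1}\log|\lambda_i|,$$ where the $\lambda_i$ are the eigenvalues of $T$ counted with spectral multiplicity. Consequently, $$\mathrm{Entp}(\beta_T)=\sum_{|\lambda_i|>1}\log|\lambda_i|.$$
   Context: $\ell$ is the usual word length function on $\mathbb Z^d$ (with respect to the standard generators). $C^*_r(\mathbb Z^d)$ is the reduced group $C^*$-algebra, $\lambda$ its (left regular) representation on $\ell^2(\mathbb Z^d)$, $C_c(\mathbb Z^d)$ the dense $*$-subalgebra of finitely supported functions $\sum c_x\delta_x$. The Fourier transform is the isomorphism $C^*_r(\mathbb Z^d)\to C(\mathbb T^d)$ taking $\delta_x$ to $u^x=u_1^{x_1}\cdots u_d^{x_d}$, with $u_1,\dots,u_d$ the generating unitaries of $C(\mathbb T^d)$. $\alpha_T$ is determined by $u^x\mapsto u^{Tx}$, and $\beta_T$ by $\delta_x\mapsto\delta_{Tx}$, $x\in\mathbb Z^d$. $M_\ell$ is the unbounded operator on $\ell^2(\mathbb Z^d)$ with domain $C_c(\mathbb Z^d)$, $M_\ell(\sum c_x\delta_x)=\sum\ell(x)c_x\delta_x$. For $f\in C_c(\mathbb Z^d)$,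 $\Delta^1_\ell(f)=[M_\ell,\lambda(f)]$, $\Delta^k_\ell(f)=[M_\ell,\Delta^{k-1}_\ell(f)]$ (bounded operators). $L^k_\ell(f)=\|\Delta^k_\ell(f)\|_{\mathrm{op}}$ for $f\in C_c(\mathbb Z^d)$ and $L^k_\ell=+\infty$ off $C_c(\mathbb Z^d)$. For a subset $Y$ of a normed space $X$ and $\delta>0$, $D(Y,\delta)$ is the infimum of $\dim Z$ over finite-dimensional subspaces $Z\subseteq X$ such that for every $y\in Y$ there is $z\in Z$ with $\|y-z\|<\delta$. Kerr's product entropy: for a unital $C^*$-algebra $A$ with unit ball $A_1$, a seminorm $L:A\to[0,+\infty]$ making $(A,L)$ a compact quantum metric space, and an automorphism $\beta$ of $A$, $\mathrm{Entp}_L(\beta)=\sup_\Omega\sup_{\delta>0}\limsup_{n\to\infty}\frac1n\log D\big(\Omega\,\beta(\Omega)\cdots\beta^{n-1}(\Omega),\delta\big)$, with $\Omega$ ranging over finite subsets of $\{a\in A_1:L(a)<+\infty\}$ and the product of sets meaning the set of all products. For an automorphism $\beta$ of $C^*_r(\Gamma)$ induced by an automorphism of a finitely generated group $\Gamma$, $\mathrm{Entp}(\beta)$ is the same quantity with $\Omega$ ranging over finite subsets of $\{f\in C_c(\Gamma):\|f\|_{\mathrm{red}}\le1\}$. *)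

theory Defs
  imports
    "HOL-Analysis.Analysis"
    "HOL-Computational_Algebra.Polynomial"
    "HOL-Library.Function_Algebras"
begin

section \<open>The Hilbert space of square-summable functions\<close>

typedef 'g ell2 = "{f :: 'g \<Rightarrow> complex. (\<lambda>x. (cmod (f x))\<^sup>2) summable_on UNIV}"
  morphisms ell2_apply Abs_ell2
  by (rule exI[of _ "\<lambda>_. 0"]) simp

setup_lifting type_definition_ell2

lemma square_summable: "(\<lambda>x. (cmod (ell2_apply \<xi> x))\<^sup>2) summable_on UNIV"
  using ell2_apply by blast

lemma square_summable_product:
  fixes f g :: "'g \<Rightarrow> complex"
  assumes "(\<lambda>x. (cmod (f x))\<^sup>2) summable_on UNIV" "(\<lambda>x. (cmod (g x))\<^sup>2) summable_on UNIV"
  shows "(\<lambda>x. cnj (f x) * g x) summable_on UNIV"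
proof -
  have s: "(\<lambda>x. (cmod (f x))\<^sup>2 + (cmod (g x))\<^sup>2) summable_on UNIV"
    using assms by (rule summable_on_add)
  have b: "cmod (cnj (f x) * g x) \<le> (cmod (f x))\<^sup>2 + (cmod (g x))\<^sup>2" for x
  proof -
    have "2 * (cmod (f x) * cmod (g x)) \<le> (cmod (f x))\<^sup>2 + (cmod (g x))\<^sup>2"
      using sum_squares_bound[of "cmod (f x)" "cmod (g x)"] by (simp add: mult.assoc)
    moreover have "0 \<le> cmod (f x) * cmod (g x)" by simp
    ultimately show ?thesis unfolding norm_mult complex_mod_cnj by linarith
  qed
  have "(\<lambda>x. cmod (cnj (f x) * g x)) summable_on UNIV"
    by (rule summable_on_comparison_test[OF s]) (use b in auto)
  then show ?thesis by (rule abs_summable_summable)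
qed

lemma square_summable_add:
  fixes f g :: "'g \<Rightarrow> complex"
  assumes "(\<lambda>x. (cmod (f x))\<^sup>2) summable_on UNIV" "(\<lambda>x. (cmod (g x))\<^sup>2) summable_on UNIV"
  shows "(\<lambda>x. (cmod (f x + g x))\<^sup>2) summable_on UNIV"
proof -
  have s: "(\<lambda>x. 2 * (cmod (f x))\<^sup>2 + 2 * (cmod (g x))\<^sup>2) summable_on UNIV"
    using assms by (intro summable_on_add summable_on_cmult_right)
  have b: "(cmod (f x + g x))\<^sup>2 \<le> 2 * (cmod (f x))\<^sup>2 + 2 * (cmod (g x))\<^sup>2" for x
  proof -
    have "(cmod (f x + g x))\<^sup>2 \<le> (cmod (f x) + cmod (g x))\<^sup>2"
      by (intro power_mono norm_triangle_ineq) simp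
    also have "\<dots> \<le> 2 * (cmod (f x))\<^sup>2 + 2 * (cmod (g x))\<^sup>2"
      using sum_squares_bound[of "cmod (f x)" "cmod (g x)"] by (simp add: power2_sum)
    finally show ?thesis .
  qed
  show ?thesis by (rule summable_on_comparison_test[OF s]) (use b in auto)
qed

lemma square_summable_scale:
  fixes f :: "'g \<Rightarrow> complex"
  assumes "(\<lambda>x. (cmod (f x))\<^sup>2) summable_on UNIV"
  shows "(\<lambda>x. (cmod (c * f x))\<^sup>2) summable_on UNIV"
  using summable_on_cmult_right[OF assms, of "(cmod c)\<^sup>2"]
  by (simp add: norm_mult power_mult_distrib)

lift_definition ell2_scale :: "complex \<Rightarrow> 'g ell2 \<Rightarrow> 'g ell2" is "\<lambda>c f x. c * f x"
  by (rule square_summable_scale)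

definition ell2_cinner :: "'g ell2 \<Rightarrow> 'g ell2 \<Rightarrow> complex" where
  "ell2_cinner \<xi> \<eta> = (\<Sum>\<^sub>\<infinity>x. cnj (ell2_apply \<xi> x) * ell2_apply \<eta> x)"

instantiation ell2 :: (type) real_inner
begin

lift_definition zero_ell2 :: "'a ell2" is "\<lambda>_. 0" by simp

lift_definition plus_ell2 :: "'a ell2 \<Rightarrow> 'a ell2 \<Rightarrow> 'a ell2" is "\<lambda>f g x. f x + g x"
  by (rule square_summable_add)

lift_definition uminus_ell2 :: "'a ell2 \<Rightarrow> 'a ell2" is "\<lambda>f x. - f x" by simp

definition minus_ell2 :: "'a ell2 \<Rightarrow> 'a ell2 \<Rightarrow> 'a ell2" where
  "minus_ell2 \<xi> \<eta> = \<xi> + - \<eta>"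

definition scaleR_ell2 :: "real \<Rightarrow> 'a ell2 \<Rightarrow> 'a ell2" where
  "scaleR_ell2 r = ell2_scale (complex_of_real r)"

definition inner_ell2 :: "'a ell2 \<Rightarrow> 'a ell2 \<Rightarrow> real" where
  "inner_ell2 \<xi> \<eta> = Re (ell2_cinner \<xi> \<eta>)"

definition norm_ell2 :: "'a ell2 \<Rightarrow> real" where
  "norm_ell2 \<xi> = sqrt (inner \<xi> \<xi>)"

definition dist_ell2 :: "'a ell2 \<Rightarrow> 'a ell2 \<Rightarrow> real" where
  "dist_ell2 \<xi> \<eta> = norm (\<xi> - \<eta>)"

definition sgn_ell2 :: "'a ell2 \<Rightarrow> 'a ell2" where
  "sgn_ell2 \<xi> = scaleR (inverse (norm \<xi>)) \<xi>"

definition uniformity_ell2 :: "('a ell2 \<times> 'a ell2) filter" where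
  "uniformity_ell2 = (INF e\<in>{0<..}. principal {(x, y). dist x y < e})"

definition open_ell2 :: "'a ell2 set \<Rightarrow> bool" where
  "open_ell2 U = (\<forall>x\<in>U. eventually (\<lambda>(x', y). x' = x \<longrightarrow> y \<in> U) uniformity)"

instance
proof
  fix a b c :: "'a ell2" and r s :: real
  note ext = ell2_apply_inject[THEN iffD1]
  show "a + b + c = a + (b + c)" by transfer (simp add: add.assoc)
  show "a + b = b + a" by transfer (simp add: add.commute)
  show "0 + a = a" by transfer simp
  show "- a + a = 0" by transfer simp
  show "a - b = a + - b" by (simp add: minus_ell2_def)
  show "r *\<^sub>R (a + b) = r *\<^sub>R a + r *\<^sub>R b"
    unfolding scaleR_ell2_def by transfer (simp add: distrib_left)
  show "(r + s) *\<^sub>R a = r *\<^sub>R a + s *\<^sub>R a"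
    unfolding scaleR_ell2_def by transfer (simp add: distrib_right)
  show "r *\<^sub>R s *\<^sub>R a = (r * s) *\<^sub>R a"
    unfolding scaleR_ell2_def by transfer (simp add: mult.assoc)
  show "1 *\<^sub>R a = a" unfolding scaleR_ell2_def by transfer simp
  show "dist a b = norm (a - b)" by (rule dist_ell2_def)
  show "sgn a = scaleR (inverse (norm a)) a" by (rule sgn_ell2_def)
  show "uniformity = (INF e\<in>{0<..}. principal {(x, y::'a ell2). dist x y < e})"
    by (rule uniformity_ell2_def)
  show "open U = (\<forall>x\<in>U. eventually (\<lambda>(x', y). x' = x \<longrightarrow> y \<in> U) uniformity)"
    for U :: "'a ell2 set" by (rule open_ell2_def)
  have smm: "(\<lambda>x. cnj (ell2_apply \<xi> x) * ell2_apply \<eta> x) summable_on UNIV" for \<xi> \<eta> :: "'a ell2"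
    by (intro square_summable_product square_summable)
  have inn: "inner \<xi> \<eta> = (\<Sum>\<^sub>\<infinity>x. Re (cnj (ell2_apply \<xi> x) * ell2_apply \<eta> x))" for \<xi> \<eta> :: "'a ell2"
    unfolding inner_ell2_def ell2_cinner_def by (rule infsum_Re[OF smm, symmetric])
  have smR: "(\<lambda>x. Re (cnj (ell2_apply \<xi> x) * ell2_apply \<eta> x)) summable_on UNIV" for \<xi> \<eta> :: "'a ell2"
    by (rule summable_on_Re[OF smm])
  show "inner a b = inner b a" unfolding inn by (simp add: mult.commute)
  show "inner (a + b) c = inner a c + inner b c"
  proof -
    have "inner (a + b) c = (\<Sum>\<^sub>\<infinity>x. Re (cnj (ell2_apply a x) * ell2_apply c x)
        + Re (cnj (ell2_apply b x) * ell2_apply c x))"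
      unfolding inn by (simp add: plus_ell2.rep_eq algebra_simps)
    also have "\<dots> = inner a c + inner b c"
      unfolding inn by (rule infsum_add[OF smR smR])
    finally show ?thesis .
  qed
  show "inner (r *\<^sub>R a) b = r * inner a b"
  proof -
    have "inner (r *\<^sub>R a) b = (\<Sum>\<^sub>\<infinity>x. r * Re (cnj (ell2_apply a x) * ell2_apply b x))"
      unfolding inn by (simp add: scaleR_ell2_def ell2_scale.rep_eq algebra_simps)
    also have "\<dots> = r * inner a b"
      unfolding inn by (rule infsum_cmult_right')
    finally show ?thesis .
  qed
  have sq: "Re (cnj z * z) = (cmod z)\<^sup>2" for z
    unfolding cmod_power2 by (simp add: power2_eq_square)
  have inn_self: "inner a a = (\<Sum>\<^sub>\<infinity>x. (cmod (ell2_apply a x))\<^sup>2)"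
    unfolding inn sq ..
  show "0 \<le> inner a a" unfolding inn_self by (rule infsum_nonneg) simp
  show "inner a a = 0 \<longleftrightarrow> a = 0"
  proof
    assume "inner a a = 0"
    then have le: "(\<Sum>\<^sub>\<infinity>x. (cmod (ell2_apply a x))\<^sup>2) \<le> 0" by (simp add: inn_self)
    have "(cmod (ell2_apply a x))\<^sup>2 = 0" for x
      by (rule nonneg_infsum_le_0D[OF le square_summable]) auto
    then show "a = 0" by (intro ext) (auto simp: zero_ell2.rep_eq)
  next
    assume "a = 0"
    then show "inner a a = 0" unfolding inn_self by (simp add: zero_ell2.rep_eq)
  qed
  show "norm a = sqrt (inner a a)" by (rule norm_ell2_def)
qed

end

lemma norm_ell2_eq: "norm \<xi> = sqrt (\<Sum>\<^sub>\<infinity>x. (cmod (ell2_apply \<xi> x))\<^sup>2)"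
proof -
  have sq: "Re (cnj z * z) = (cmod z)\<^sup>2" for z
    unfolding cmod_power2 by (simp add: power2_eq_square)
  have "inner \<xi> \<xi> = (\<Sum>\<^sub>\<infinity>x. Re (cnj (ell2_apply \<xi> x) * ell2_apply \<xi> x))"
    unfolding inner_ell2_def ell2_cinner_def
    by (rule infsum_Re[symmetric]) (intro square_summable_product square_summable)
  then show ?thesis unfolding norm_ell2_def sq by simp
qed

lemma norm_ell2_scale: "norm (ell2_scale c \<xi>) = cmod c * norm \<xi>"
  unfolding norm_ell2_eq ell2_scale.rep_eq norm_mult power_mult_distrib infsum_cmult_right'
  by (simp add: real_sqrt_mult)


section \<open>Bounded operators\<close>

text \<open>
  Bounded operators are elements of \<^typ>\<open>'g ell2 \<Rightarrow>\<^sub>L 'g ell2\<close>, which also contains operators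
  that are only real linear; every operator in the algebras below is complex linear.
\<close>

lemma bounded_linear_ell2_scale: "bounded_linear (ell2_scale c)"
proof (rule bounded_linear_intro[where K = "cmod c"])
  fix \<xi> \<eta> :: "'a ell2" and r :: real
  show "ell2_scale c (\<xi> + \<eta>) = ell2_scale c \<xi> + ell2_scale c \<eta>"
    by transfer (simp add: distrib_left)
  show "ell2_scale c (r *\<^sub>R \<xi>) = r *\<^sub>R ell2_scale c \<xi>"
    unfolding scaleR_ell2_def by transfer (simp add: mult.left_commute)
  show "norm (ell2_scale c \<xi>) \<le> norm \<xi> * cmod c"
    by (simp add: norm_ell2_scale mult.commute)
qed

definition op_scale :: "complex \<Rightarrow> ('g ell2 \<Rightarrow>\<^sub>L 'g ell2) \<Rightarrow> ('g ell2 \<Rightarrow>\<^sub>L 'g ell2)" where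
  "op_scale c a = Blinfun (\<lambda>\<xi>. ell2_scale c (blinfun_apply a \<xi>))"

lemma op_scale_apply: "blinfun_apply (op_scale c a) \<xi> = ell2_scale c (blinfun_apply a \<xi>)"
  unfolding op_scale_def
  by (subst bounded_linear_Blinfun_apply)
     (rule bounded_linear_compose[OF bounded_linear_ell2_scale blinfun.bounded_linear_right] refl)+

global_interpretation op: vector_space "op_scale :: complex \<Rightarrow> ('g ell2 \<Rightarrow>\<^sub>L 'g ell2) \<Rightarrow> _"
proof
  fix c d :: complex and a b :: "'g ell2 \<Rightarrow>\<^sub>L 'g ell2"
  have l: "ell2_scale c (\<xi> + \<eta>) = ell2_scale c \<xi> + ell2_scale c \<eta>"
    "ell2_scale (c + d) \<xi> = ell2_scale c \<xi> + ell2_scale d \<xi>"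
    "ell2_scale c (ell2_scale d \<xi>) = ell2_scale (c * d) \<xi>"
    "ell2_scale 1 \<xi> = \<xi>" for \<xi> \<eta> :: "'g ell2"
    by (transfer, simp add: algebra_simps)+
  show "op_scale c (a + b) = op_scale c a + op_scale c b"
    by (rule blinfun_eqI) (simp add: op_scale_apply plus_blinfun.rep_eq l)
  show "op_scale (c + d) a = op_scale c a + op_scale d a"
    by (rule blinfun_eqI) (simp add: op_scale_apply plus_blinfun.rep_eq l)
  show "op_scale c (op_scale d a) = op_scale (c * d) a"
    by (rule blinfun_eqI) (simp add: op_scale_apply l)
  show "op_scale 1 a = a"
    by (rule blinfun_eqI) (simp add: op_scale_apply l)
qed

definition op_star :: "('g ell2 \<Rightarrow>\<^sub>L 'g ell2) \<Rightarrow> ('g ell2 \<Rightarrow>\<^sub>L 'g ell2)" where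
  "op_star a = (THE b. \<forall>\<xi> \<eta>. ell2_cinner (blinfun_apply a \<xi>) \<eta> = ell2_cinner \<xi> (blinfun_apply b \<eta>))"


section \<open>C*-algebras and product entropy\<close>

text \<open>
  Addition is that of the ambient type.  The definitions below only use the algebraic structure and
  the norm and are total; they are meant for unital C*-algebras, and \<open>Entp_seminorm A L\<close> for \<open>L\<close>
  turning \<open>A\<close> into a compact quantum metric space, a condition which does not enter the formula.
\<close>

record 'a cstar =
  cs_carrier :: "'a set"
  cs_scale :: "complex \<Rightarrow> 'a \<Rightarrow> 'a"
  cs_mult :: "'a \<Rightarrow> 'a \<Rightarrow> 'a"
  cs_one :: 'a
  cs_star :: "'a \<Rightarrow> 'a"
  cs_norm :: "'a \<Rightarrow> real"

definition star_isomorphism ::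
  "'a::ab_group_add cstar \<Rightarrow> 'b::ab_group_add cstar \<Rightarrow> ('a \<Rightarrow> 'b) \<Rightarrow> bool" where
  "star_isomorphism A B \<phi> \<longleftrightarrow>
     bij_betw \<phi> (cs_carrier A) (cs_carrier B) \<and>
     (\<forall>a\<in>cs_carrier A. \<forall>b\<in>cs_carrier A. \<phi> (a + b) = \<phi> a + \<phi> b) \<and>
     (\<forall>c. \<forall>a\<in>cs_carrier A. \<phi> (cs_scale A c a) = cs_scale B c (\<phi> a)) \<and>
     (\<forall>a\<in>cs_carrier A. \<forall>b\<in>cs_carrier A. \<phi> (cs_mult A a b) = cs_mult B (\<phi> a) (\<phi> b)) \<and>
     (\<forall>a\<in>cs_carrier A. \<phi> (cs_star A a) = cs_star B (\<phi> a))"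

abbreviation star_automorphism :: "'a::ab_group_add cstar \<Rightarrow> ('a \<Rightarrow> 'a) \<Rightarrow> bool" where
  "star_automorphism A \<equiv> star_isomorphism A A"

text \<open>\<open>approx_dim A Y \<delta>\<close> is \<open>D(Y, \<delta>)\<close> with \<open>A\<close> as the ambient normed space; it is \<open>\<infinity>\<close> if no
  finite-dimensional subspace approximates \<open>Y\<close>.\<close>

definition approx_dim :: "'a::ab_group_add cstar \<Rightarrow> 'a set \<Rightarrow> real \<Rightarrow> enat" where
  "approx_dim A Y \<delta> =
     (INF Z \<in> {Z. Z \<subseteq> cs_carrier A \<and> (\<exists>B. finite B \<and> module.span (cs_scale A) B = Z) \<and>
                  (\<forall>y\<in>Y. \<exists>z\<in>Z. cs_norm A (y - z) < \<delta>)}.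
        enat (vector_space.dim (cs_scale A) Z))"

definition log_enat :: "enat \<Rightarrow> ereal" where
  "log_enat n = (case n of enat m \<Rightarrow> if m = 0 then -\<infinity> else ereal (ln (real m)) | \<infinity> \<Rightarrow> \<infinity>)"

text \<open>\<open>orbit_prod A \<beta> \<Omega> n\<close> is \<open>\<Omega> \<beta>(\<Omega>) \<cdots> \<beta>\<^sup>n\<^sup>-\<^sup>1(\<Omega>)\<close>.\<close>

fun orbit_prod :: "'a cstar \<Rightarrow> ('a \<Rightarrow> 'a) \<Rightarrow> 'a set \<Rightarrow> nat \<Rightarrow> 'a set" where
  "orbit_prod A \<beta> \<Omega> 0 = {cs_one A}"
| "orbit_prod A \<beta> \<Omega> (Suc n) = {cs_mult A p ((\<beta> ^^ n) w) | p w. p \<in> orbit_prod A \<beta> \<Omega> n \<and> w \<in> \<Omega>}"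

definition product_entropy_over :: "'a::ab_group_add cstar \<Rightarrow> 'a set \<Rightarrow> ('a \<Rightarrow> 'a) \<Rightarrow> ereal" where
  "product_entropy_over A S \<beta> =
     (SUP \<Omega> \<in> {\<Omega>. finite \<Omega> \<and> \<Omega> \<subseteq> S}. SUP \<delta> \<in> {0<..}.
        limsup (\<lambda>n. ereal (1 / real n) * log_enat (approx_dim A (orbit_prod A \<beta> \<Omega> n) \<delta>)))"

definition Entp_seminorm :: "'a::ab_group_add cstar \<Rightarrow> ('a \<Rightarrow> ereal) \<Rightarrow> ('a \<Rightarrow> 'a) \<Rightarrow> ereal" where
  "Entp_seminorm A L = product_entropy_over A {a \<in> cs_carrier A. cs_norm A a \<le> 1 \<and> L a < \<infinity>}"


section \<open>The reduced group C*-algebra\<close>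

text \<open>Groups are written additively but need not be commutative: \<open>translation g\<close> maps the basis
  vector at \<open>x\<close> to the one at \<open>g + x\<close>.\<close>

lift_definition ell2_translate :: "'g::group_add \<Rightarrow> 'g ell2 \<Rightarrow> 'g ell2" is "\<lambda>g f x. f (- g + x)"
proof -
  fix g :: 'g and f :: "'g \<Rightarrow> complex"
  have "bij_betw (\<lambda>x. - g + x) UNIV UNIV"
    by (rule bij_betw_byWitness[where f' = "\<lambda>x. g + x"]) (auto simp: add.assoc[symmetric])
  from summable_on_reindex_bij_betw[OF this, of "\<lambda>x. (cmod (f x))\<^sup>2"]
  show "(\<lambda>x. (cmod (f x))\<^sup>2) summable_on UNIV \<Longrightarrow> (\<lambda>x. (cmod (f (- g + x)))\<^sup>2) summable_on UNIV"
    by simp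
qed

lemma norm_ell2_translate: "norm (ell2_translate g \<xi>) = norm \<xi>"
proof -
  have "bij_betw (\<lambda>x. - g + x) UNIV UNIV"
    by (rule bij_betw_byWitness[where f' = "\<lambda>x. g + x"]) (auto simp: add.assoc[symmetric])
  from infsum_reindex_bij_betw[OF this, of "\<lambda>x. (cmod (ell2_apply \<xi> x))\<^sup>2"]
  show ?thesis unfolding norm_ell2_eq ell2_translate.rep_eq by simp
qed

lemma bounded_linear_ell2_translate: "bounded_linear (ell2_translate g)"
proof (rule bounded_linear_intro[where K = 1])
  fix \<xi> \<eta> :: "'a ell2" and r :: real
  show "ell2_translate g (\<xi> + \<eta>) = ell2_translate g \<xi> + ell2_translate g \<eta>" by transfer simp
  show "ell2_translate g (r *\<^sub>R \<xi>) = r *\<^sub>R ell2_translate g \<xi>"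
    unfolding scaleR_ell2_def by transfer simp
  show "norm (ell2_translate g \<xi>) \<le> norm \<xi> * 1" by (simp add: norm_ell2_translate)
qed

definition translation :: "'g::group_add \<Rightarrow> 'g ell2 \<Rightarrow>\<^sub>L 'g ell2" where
  "translation g = Blinfun (ell2_translate g)"

lemma translation_apply: "blinfun_apply (translation g) \<xi> = ell2_translate g \<xi>"
  by (simp add: translation_def bounded_linear_Blinfun_apply bounded_linear_ell2_translate)

definition fin_supp :: "('g \<Rightarrow> complex) set" where
  "fin_supp = {f. finite {x. f x \<noteq> 0}}"

definition left_regular :: "('g::group_add \<Rightarrow> complex) \<Rightarrow> 'g ell2 \<Rightarrow>\<^sub>L 'g ell2" where
  "left_regular f = (\<Sum>g | f g \<noteq> 0. op_scale (f g) (translation g))"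

text \<open>\<open>C\<^sub>c(\<Gamma>)\<close>, as a subalgebra of the bounded operators; its elements \<open>\<delta>\<^sub>g\<close> are the translations.\<close>

definition group_algebra :: "('g::group_add ell2 \<Rightarrow>\<^sub>L 'g ell2) set" where
  "group_algebra = left_regular ` fin_supp"

definition reduced_cstar :: "('g::group_add ell2 \<Rightarrow>\<^sub>L 'g ell2) cstar" where
  "reduced_cstar = \<lparr>cs_carrier = closure group_algebra, cs_scale = op_scale, cs_mult = (o\<^sub>L),
     cs_one = id_blinfun, cs_star = op_star, cs_norm = norm\<rparr>"

definition Entp :: "(('g::group_add ell2 \<Rightarrow>\<^sub>L 'g ell2) \<Rightarrow> ('g ell2 \<Rightarrow>\<^sub>L 'g ell2)) \<Rightarrow> ereal" where
  "Entp = product_entropy_over reduced_cstar {a \<in> group_algebra. norm a \<le> 1}"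


section \<open>Length functions and higher-derivation seminorms\<close>

definition word_length :: "'g::group_add set \<Rightarrow> 'g \<Rightarrow> nat" where
  "word_length S x = (LEAST n. \<exists>w. length w = n \<and> set w \<subseteq> S \<union> uminus ` S \<and> sum_list w = x)"

definition std_length :: "int ^ 'd \<Rightarrow> nat" where
  "std_length = word_length (range (\<lambda>i. axis i 1))"

definition ell2_fin_supp :: "'g ell2 set" where
  "ell2_fin_supp = {\<xi>. ell2_apply \<xi> \<in> fin_supp}"

text \<open>The unbounded operator \<open>M\<^sub>\<ell>\<close> (\<open>length_mult len\<close>) has domain \<^const>\<open>ell2_fin_supp\<close> and is only used there (outside
  of it the value need not be meaningful).  The operators in the group algebra preserve this
  domain, so the iterated commutators \<open>\<Delta>\<^sup>k\<^sub>\<ell>\<close> are defined on it, and the operator norm of their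
  bounded extension is the supremum over the unit ball of this dense domain.\<close>

definition length_mult :: "('g \<Rightarrow> nat) \<Rightarrow> 'g ell2 \<Rightarrow> 'g ell2" where
  "length_mult len \<xi> = Abs_ell2 (\<lambda>x. of_nat (len x) * ell2_apply \<xi> x)"

fun iter_commutator :: "('g \<Rightarrow> nat) \<Rightarrow> nat \<Rightarrow> ('g ell2 \<Rightarrow>\<^sub>L 'g ell2) \<Rightarrow> 'g ell2 \<Rightarrow> 'g ell2" where
  "iter_commutator len 0 a = blinfun_apply a"
| "iter_commutator len (Suc k) a =
     (\<lambda>\<xi>. length_mult len (iter_commutator len k a \<xi>) - iter_commutator len k a (length_mult len \<xi>))"

definition length_seminorm ::
  "('g::group_add \<Rightarrow> nat) \<Rightarrow> nat \<Rightarrow> ('g ell2 \<Rightarrow>\<^sub>L 'g ell2) \<Rightarrow> ereal" where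
  "length_seminorm len k a =
     (if a \<in> group_algebra
      then SUP \<xi> \<in> {\<xi> \<in> ell2_fin_supp. norm \<xi> \<le> 1}. ereal (norm (iter_commutator len k a \<xi>))
      else \<infinity>)"


section \<open>Continuous functions on the torus\<close>

definition torus :: "(complex ^ 'd) set" where
  "torus = {z. \<forall>i. cmod (z $ i) = 1}"

text \<open>Functions on the torus are normalised to vanish outside of it.\<close>

definition C_torus :: "(complex ^ 'd \<Rightarrow> complex) cstar" where
  "C_torus = \<lparr>cs_carrier = {f. continuous_on torus f \<and> (\<forall>z. z \<notin> torus \<longrightarrow> f z = 0)},
     cs_scale = (\<lambda>c f z. c * f z), cs_mult = (\<lambda>f g z. f z * g z),
     cs_one = (\<lambda>z. if z \<in> torus then 1 else 0), cs_star = (\<lambda>f z. cnj (f z)),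
     cs_norm = (\<lambda>f. SUP z\<in>torus. cmod (f z))\<rparr>"

definition torus_char :: "int ^ 'd \<Rightarrow> complex ^ 'd \<Rightarrow> complex" where
  "torus_char x z = (if z \<in> torus then \<Prod>i\<in>UNIV. (z $ i) powi (x $ i) else 0)"


section \<open>Eigenvalues\<close>

definition complex_matrix :: "int ^ 'n ^ 'm \<Rightarrow> complex ^ 'n ^ 'm" where
  "complex_matrix T = (\<chi> i j. of_int (T $ i $ j))"

definition eigenvalues :: "complex ^ 'n ^ 'n \<Rightarrow> complex set" where
  "eigenvalues A = {\<mu>. \<exists>v. v \<noteq> 0 \<and> A *v v = \<mu> *s v}"

definition charpoly :: "complex ^ 'n ^ 'n \<Rightarrow> complex poly" where
  "charpoly A = det (\<chi> i j. (if i = j then [:0, 1:] else 0) - [:A $ i $ j:])"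

definition spectral_multiplicity :: "complex \<Rightarrow> complex ^ 'n ^ 'n \<Rightarrow> nat" where
  "spectral_multiplicity \<mu> A = order \<mu> (charpoly A)"

end

theory Submission
  imports Defs "Jordan_Normal_Form.Schur_Decomposition"
begin

text \<open>
  On elements of the group algebra all iterated commutators with \<open>M\<^sub>\<ell>\<close> are bounded, because the word
  length changes by a bounded amount under a translation.  Hence every \<open>L\<^sup>k\<^sub>\<ell>\<close> is finite exactly on
  \<open>C\<^sub>c(\<int>\<^sup>d)\<close>, and both entropies are the same quantity.  As \<open>\<beta>\<^sub>T\<close> permutes the translations by
  \<open>\<delta>\<^sub>x \<mapsto> \<delta>\<^bsub>Tx\<^esub>\<close>, products along the orbit of elements supported in \<open>K\<close> are supported in
  \<open>S\<^sub>n = K + TK + \<dots> + T\<^sup>n\<^sup>-\<^sup>1K\<close>, so that \<open>D \<le> card S\<^sub>n\<close>; conversely the translations by \<open>S\<^sub>n\<close> map the basis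
  vector at \<open>0\<close> to orthonormal vectors, which a subspace approximates only if its dimension is
  proportional to \<open>card S\<^sub>n\<close>.  It remains to compute the growth of \<open>card S\<^sub>n\<close>.

  Upper bound: in triangular coordinates \<open>Q\<close>, with eigenvalues of decreasing modulus, the \<open>i\<close>-th coordinate
  of a point of \<open>S\<^sub>n\<close> is \<open>O((max 1 |\<lambda>\<^sub>i| + \<epsilon>)\<^sup>n)\<close>; selecting the real or the imaginary part of each row of \<open>Q\<close>
  gives real coordinates, so the number of integer points is bounded by the product of these bounds.

  Lower bound: every integer point near \<open>[0,1]\<^sup>d + T\<^sup>n[0,1]\<^sup>d\<close> lies in \<open>S\<^bsub>n+1\<^esub>\<close> for a large box \<open>K\<close>, by rounding
  and carrying the remainders to lower powers of \<open>T\<close>.  For \<open>0 \<le> t \<le> 1\<close> that set contains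
  \<open>(t + T\<^sup>n)[0,1]\<^sup>d\<close>, of volume \<open>\<Prod>\<^sub>i |t + \<lambda>\<^sub>i\<^sup>n|\<close>, and \<open>t\<close> can be chosen such that this is at least a constant times
  \<open>\<Prod>\<^sub>i max 1 |\<lambda>\<^sub>i|\<^sup>n\<close>.
\<close>

no_notation Matrix.vec_index (infixl "$" 100)
hide_const (open) Determinant.det Matrix.mat Matrix.vec Matrix.row Matrix.map_vec Coset.order Matrix.orthogonal
hide_fact (open) Determinant.det_def Matrix.mat_def Matrix.vec_eq_iff Matrix.orthogonal_def


section \<open>Triangular form and eigenvalues\<close>

text \<open>Transport along a numbering \<open>r\<close> from matrices over \<open>{0..<n}\<close>,
  where the Schur decomposition lives, to matrices over a finite index type.\<close>

definition cartesian_of :: "('n \<Rightarrow> nat) \<Rightarrow> complex Matrix.mat \<Rightarrow> complex ^ 'n ^ 'n" where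
  "cartesian_of r M = (\<chi> i j. M $$ (r i, r j))"

lemma cartesian_of_mult:
  fixes r :: "'n::finite \<Rightarrow> nat"
  assumes r: "bij_betw r UNIV {0..<CARD('n)}"
    and "M \<in> carrier_mat CARD('n) CARD('n)" "N \<in> carrier_mat CARD('n) CARD('n)"
  shows "cartesian_of r (M * N) = cartesian_of r M ** cartesian_of r N"
proof -
  have lt: "r i < CARD('n)" for i using r by (auto simp: bij_betw_def)
  show ?thesis
    using assms(2,3) lt
    by (auto simp: cartesian_of_def matrix_matrix_mult_def vec_eq_iff scalar_prod_def
        sum.reindex_bij_betw[OF r, symmetric])
qed

text \<open>A Schur decomposition with sorted eigenvalue list, moved to the index type by
  \<open>cartesian_of\<close>. Triangularity refers to the numbering \<open>r\<close>, since the
  index type carries no order. The decreasing moduli on the diagonal are what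
  \<open>triangular_orbit_bound\<close> relies on.\<close>

lemma triangular_form:
  fixes A :: "complex ^ 'n ^ 'n"
  obtains r :: "'n \<Rightarrow> nat" and Q U :: "complex ^ 'n ^ 'n"
  where "inj r" "det Q \<noteq> 0" "Q ** A = U ** Q"
    "\<And>i j. r j < r i \<Longrightarrow> U $ i $ j = 0"
    "\<And>i j. r i \<le> r j \<Longrightarrow> cmod (U $ j $ j) \<le> cmod (U $ i $ i)"
proof -
  let ?n = "CARD('n)"
  obtain r :: "'n \<Rightarrow> nat" where r: "bij_betw r UNIV {0..<?n}"
    using ex_bij_betw_finite_nat[of "UNIV :: 'n set"] by auto
  have inj: "inj r" and lt: "r i < ?n" for i using r by (auto simp: bij_betw_def)
  define f where "f = inv_into UNIV r"
  have fr: "f (r i) = i" for i unfolding f_def using inj by simp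
  define M where "M = Matrix.mat ?n ?n (\<lambda>(i, j). A $ f i $ f j)"
  have M: "M \<in> carrier_mat ?n ?n" by (simp add: M_def)
  obtain es where es: "char_poly M = (\<Prod>e\<leftarrow>es. [:- e, 1:])" "length es = ?n"
    using char_poly_factorized[OF M] by blast
  \<comment> \<open>\<open>sort_key\<close> sorts upwards, hence the minus sign for decreasing
    moduli; permuting the roots does not change the product of the linear factors.\<close>
  define es' where "es' = sort_key (\<lambda>e. - cmod e) es"
  have "mset (map (\<lambda>e. [:- e, 1:]) es') = mset (map (\<lambda>e. [:- e, 1:]) es)"
    by (simp add: es'_def)
  then have "(\<Prod>e\<leftarrow>es'. [:- e, 1:]) = (\<Prod>e\<leftarrow>es. [:- e, 1:])"
    by (metis prod_mset_prod_list)
  with es have c: "char_poly M = (\<Prod>e\<leftarrow>es'. [:- e, 1:])" by simp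
  obtain B P Q where S: "schur_decomposition M es' = (B, P, Q)"
    by (cases "schur_decomposition M es'")
  from schur_decomposition[OF M c S]
  have w: "similar_mat_wit M B P Q" and u: "upper_triangular B" and d: "diag_mat B = es'" by auto
  note w = similar_mat_witD2[OF M w]
  have QM: "Q * M = B * Q"
  proof -
    have "Q * M = Q * (P * (B * Q))" using w by (simp add: assoc_mult_mat[of P ?n ?n B ?n Q ?n])
    also have "\<dots> = (Q * P) * (B * Q)"
      using w by (intro assoc_mult_mat[of Q ?n ?n P ?n "B * Q" ?n, symmetric]) auto
    also have "\<dots> = B * Q" using w by simp
    finally show ?thesis .
  qed
  let ?H = "cartesian_of r"
  have HM: "?H M = A" by (simp add: cartesian_of_def M_def lt fr vec_eq_iff)
  have H1: "?H (1\<^sub>m ?n) = mat 1"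
    using inj by (auto simp: cartesian_of_def mat_def lt vec_eq_iff inj_eq mat_def)
  have PQ: "?H P ** ?H Q = mat 1"
    using cartesian_of_mult[OF r, of P Q] w H1 by simp
  have diag: "B $$ (i, i) = es' ! i" if "i < ?n" for i
  proof -
    have "es' ! i = map (\<lambda>i. B $$ (i, i)) [0..<dim_row B] ! i"
      unfolding d[symmetric] diag_mat_def ..
    then show ?thesis using that w by simp
  qed
  have len: "length es' = ?n" by (simp add: es'_def es)
  have sorted: "sorted (map (\<lambda>e. - cmod e) es')" by (simp add: es'_def)
  show thesis
  proof (rule that[of r "?H Q" "?H B"])
    show "inj r" by (rule inj)
    have "det (?H P) * det (?H Q) = 1" using PQ det_mul[of "?H P" "?H Q"] by simp
    then show "det (?H Q) \<noteq> 0" by auto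
    show "?H Q ** A = ?H B ** ?H Q"
      using cartesian_of_mult[OF r, of Q M] cartesian_of_mult[OF r, of B Q] w M QM HM by simp
    show "?H B $ i $ j = 0" if "r j < r i" for i j
      using upper_triangularD[OF u that] lt w by (simp add: cartesian_of_def)
    show "cmod (?H B $ j $ j) \<le> cmod (?H B $ i $ i)" if "r i \<le> r j" for i j
      using sorted_nth_mono[OF sorted that] lt[of i] lt[of j] by (simp add: cartesian_of_def diag len)
  qed
qed

text \<open>In the Leibniz formula every permutation \<open>p\<close> other than the identity lowers
  \<open>r\<close> somewhere: if \<open>r i \<le> r (p i)\<close> for all \<open>i\<close>, then,
  both sides having the same sum, equality holds throughout, and injectivity of \<open>r\<close>
  gives \<open>p = id\<close>.\<close>

lemma det_triangular:
  fixes M :: "'a::comm_ring_1 ^ 'n ^ 'n" and r :: "'n \<Rightarrow> nat"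
  assumes r: "inj r" and M: "\<And>i j. r j < r i \<Longrightarrow> M $ i $ j = 0"
  shows "det M = (\<Prod>i\<in>UNIV. M $ i $ i)"
proof -
  have zero: "of_int (sign p) * (\<Prod>i\<in>UNIV. M $ i $ p i) = 0"
    if p: "p permutes UNIV" and "p \<noteq> id" for p
  proof -
    have "\<exists>i. r (p i) < r i"
    proof (rule ccontr)
      assume "\<not> ?thesis"
      then have ge: "r i \<le> r (p i)" for i by (simp add: not_less)
      have "(\<Sum>i\<in>UNIV. r i) = (\<Sum>i\<in>UNIV. r (p i))"
        using sum.permute[OF p, of r] by (simp add: o_def)
      then have "r i = r (p i)" for i
        using sum_mono_inv[of r UNIV "\<lambda>i. r (p i)" i] ge by simp
      then have "p = id" using r by (auto simp: fun_eq_iff inj_eq)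
      with \<open>p \<noteq> id\<close> show False by simp
    qed
    then obtain i where "M $ i $ p i = 0" using M by blast
    then have "(\<Prod>i\<in>UNIV. M $ i $ p i) = 0" by (intro prod_zero) auto
    then show ?thesis by simp
  qed
  have "det M = (\<Sum>p\<in>{id}. of_int (sign p) * (\<Prod>i\<in>UNIV. M $ i $ p i))"
    unfolding det_def
    by (rule sum.mono_neutral_right) (auto simp: permutes_id finite_permutations intro: zero)
  then show ?thesis by simp
qed

section \<open>Powers of matrices and their triangular form\<close>

definition matpow :: "'a::semiring_1 ^ 'n ^ 'n \<Rightarrow> nat \<Rightarrow> 'a ^ 'n ^ 'n" where
  "matpow A n = ((**) A ^^ n) (mat 1)"

lemma matpow_0: "matpow A 0 = mat 1"
  and matpow_Suc: "matpow A (Suc n) = A ** matpow A n"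
  by (simp_all add: matpow_def)

lemma matpow_vector: "matpow A n *v x = ((*v) A ^^ n) x"
  by (induction n) (simp_all add: matpow_0 matpow_Suc matrix_vector_mul_assoc[symmetric])

lemma matpow_intertwine:
  assumes "Q ** A = U ** Q" shows "Q ** matpow A n = matpow U n ** Q"
proof (induction n)
  case (Suc n)
  have "Q ** matpow A (Suc n) = (Q ** A) ** matpow A n" by (simp add: matpow_Suc matrix_mul_assoc)
  also have "\<dots> = U ** (Q ** matpow A n)" by (simp add: assms matrix_mul_assoc)
  also have "\<dots> = matpow U (Suc n) ** Q" by (simp add: Suc matpow_Suc matrix_mul_assoc)
  finally show ?case .
qed (simp add: matpow_0)

lemma matpow_triangular:
  fixes U :: "'a::comm_ring_1 ^ 'n ^ 'n" and r :: "'n \<Rightarrow> nat"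
  assumes r: "inj r" and U: "\<And>i j. r j < r i \<Longrightarrow> U $ i $ j = 0"
  shows "(\<forall>i j. r j < r i \<longrightarrow> matpow U n $ i $ j = 0) \<and> (\<forall>i. matpow U n $ i $ i = (U $ i $ i) ^ n)"
proof (induction n)
  case 0
  show ?case by (auto simp: matpow_0 mat_def)
next
  case (Suc n)
  have e: "matpow U (Suc n) $ i $ j = (\<Sum>k\<in>UNIV. U $ i $ k * matpow U n $ k $ j)" for i j
    by (simp add: matpow_Suc matrix_matrix_mult_def)
  \<comment> \<open>A summand can survive only if \<open>r i \<le> r k\<close> and
    \<open>r k \<le> r j\<close>.\<close>
  have z: "U $ i $ k * matpow U n $ k $ j = 0" if "r k < r i \<or> r j < r k" for i j k
    using that U Suc by auto
  have "matpow U (Suc n) $ i $ j = 0" if "r j < r i" for i j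
    unfolding e by (intro sum.neutral ballI z) (use that in linarith)
  moreover have "matpow U (Suc n) $ i $ i = U $ i $ i ^ Suc n" for i
  proof -
    have "matpow U (Suc n) $ i $ i = (\<Sum>k\<in>{i}. U $ i $ k * matpow U n $ k $ i)"
      unfolding e
    proof (rule sum.mono_neutral_right)
      show "\<forall>k\<in>UNIV - {i}. U $ i $ k * matpow U n $ k $ i = 0"
        using r by (intro ballI z) (metis DiffD2 injD linorder_neqE_nat singletonI)
    qed auto
    then show ?thesis using Suc by simp
  qed
  ultimately show ?case by blast
qed

lemma mat_mult_commute:
  fixes Q :: "'a::comm_ring_1 ^ 'n ^ 'n"
  shows "Q ** mat t = mat t ** Q"
  by (simp add: vec_eq_iff matrix_matrix_mult_def mat_def
      if_distrib[of "(*) _"] if_distrib[of "\<lambda>x. x * _"] mult.commute cong: if_cong)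

text \<open>Scalar matrices commute with \<open>Q\<close>, so \<open>Q\<close> intertwines
  \<open>mat t + A\<close> with \<open>mat t + U\<close>. Used with \<open>- A\<close> for the
  characteristic polynomial and with powers of \<open>A\<close> for the volume of the image of a
  cube.\<close>

lemma det_mat_plus_similar:
  fixes A :: "'a::idom ^ 'n ^ 'n" and r :: "'n \<Rightarrow> nat"
  assumes r: "inj r" and Q: "det Q \<noteq> 0" "Q ** A = U ** Q"
    and U: "\<And>i j. r j < r i \<Longrightarrow> U $ i $ j = 0"
  shows "det (mat t + A) = (\<Prod>i\<in>UNIV. t + U $ i $ i)"
proof -
  let ?m = "mat t :: 'a ^ 'n ^ 'n"
  have "Q ** (?m + A) = (?m + U) ** Q"
    unfolding matrix_add_ldistrib mat_mult_commute Q
    by (intro vec_eq_iff[THEN iffD2] allI)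
      (simp add: matrix_matrix_mult_def sum.distrib distrib_right)
  then have "det Q * det (?m + A) = det (?m + U) * det Q" by (metis det_mul)
  with Q have "det (?m + A) = det (?m + U)" by simp
  also have "\<dots> = (\<Prod>i\<in>UNIV. (?m + U) $ i $ i)"
    by (rule det_triangular[OF r]) (auto simp: U mat_def)
  finally show ?thesis by (simp add: mat_def)
qed

lemma det_mat_plus_matpow:
  fixes A :: "'a::idom ^ 'n ^ 'n" and r :: "'n \<Rightarrow> nat"
  assumes r: "inj r" and Q: "det Q \<noteq> 0" "Q ** A = U ** Q"
    and U: "\<And>i j. r j < r i \<Longrightarrow> U $ i $ j = 0"
  shows "det (mat t + matpow A n) = (\<Prod>i\<in>UNIV. t + (U $ i $ i) ^ n)"
  using det_mat_plus_similar[OF r Q(1) matpow_intertwine[OF Q(2)], of n t] matpow_triangular[OF r U, of n]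
  by simp

section \<open>Characteristic polynomial and multiplicities\<close>

lemma poly_charpoly: "poly (charpoly A) x = det (mat x - A)"
  by (auto simp: charpoly_def det_def poly_sum poly_prod mat_def
      intro!: sum.cong prod.cong)

text \<open>Both sides agree at every point, by \<open>det_mat_plus_similar\<close> for
  \<open>- A\<close> and \<open>- U\<close>, and polynomials over an infinite field are determined
  by their values.\<close>

lemma charpoly_similar:
  fixes A :: "complex ^ 'n ^ 'n" and r :: "'n \<Rightarrow> nat"
  assumes r: "inj r" and Q: "det Q \<noteq> 0" "Q ** A = U ** Q"
    and U: "\<And>i j. r j < r i \<Longrightarrow> U $ i $ j = 0"
  shows "charpoly A = (\<Prod>i\<in>UNIV. [:- (U $ i $ i), 1:])"
proof (rule poly_eq_poly_eq_iff[THEN iffD1], rule ext)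
  fix x
  have "Q ** (- A) = (- U) ** Q"
  proof (intro vec_eq_iff[THEN iffD2] allI)
    fix i j
    have "(Q ** A) $ i $ j = (U ** Q) $ i $ j" by (simp add: Q(2))
    then show "(Q ** (- A)) $ i $ j = ((- U) ** Q) $ i $ j"
      by (simp add: matrix_matrix_mult_def sum_negf)
  qed
  from det_mat_plus_similar[OF r Q(1) this] U
  show "poly (charpoly A) x = poly (\<Prod>i\<in>UNIV. [:- (U $ i $ i), 1:]) x"
    by (simp add: poly_charpoly poly_prod)
qed

lemma eigenvalues_roots: "eigenvalues A = {x. poly (charpoly A) x = 0}"
proof -
  have "(\<exists>v. v \<noteq> 0 \<and> A *v v = x *s v) \<longleftrightarrow> det (mat x - A) = 0" for x
  proof -
    let ?B = "mat x - A"
    have e: "?B *v v = x *s v - A *v v" for v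
      by (intro vec_eq_iff[THEN iffD2] allI) (simp add: matrix_vector_mult_def left_diff_distrib sum_subtractf
          mat_def if_distrib[of "\<lambda>x. x * _"] cong: if_cong)
    have "det ?B \<noteq> 0 \<longleftrightarrow> (\<forall>v. ?B *v v = 0 \<longrightarrow> v = 0)"
      by (simp add: invertible_det_nz[symmetric] invertible_left_inverse matrix_left_invertible_ker)
    then show ?thesis unfolding e by auto
  qed
  then show ?thesis by (simp add: eigenvalues_def poly_charpoly)
qed

lemma order_prod_linear:
  fixes u :: "'i \<Rightarrow> 'a::field"
  assumes "finite I"
  shows "order \<mu> (\<Prod>i\<in>I. [:- u i, 1:]) = card {i \<in> I. u i = \<mu>}"
  using assms
proof (induction I rule: finite_induct)
  case (insert i I)
  have "[:- u i, 1:] * (\<Prod>i\<in>I. [:- u i, 1:]) \<noteq> 0" using insert(1) by (simp del: mult_pCons_left)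
  from order_mult[OF this]
  have "order \<mu> (\<Prod>i\<in>insert i I. [:- u i, 1:]) = order \<mu> [:- u i, 1:] + card {i \<in> I. u i = \<mu>}"
    using insert by (simp del: mult_pCons_left)
  also have "order \<mu> [:- u i, 1:] = (if u i = \<mu> then 1 else 0)"
    using order_power_n_n[of \<mu> 1] by (auto intro: order_0I)
  also have "(if u i = \<mu> then 1 else 0) + card {i \<in> I. u i = \<mu>} = card {j \<in> insert i I. u j = \<mu>}"
  proof -
    have "{j \<in> insert i I. u j = \<mu>} = (if u i = \<mu> then insert i {i \<in> I. u i = \<mu>} else {i \<in> I. u i = \<mu>})"
      by auto
    then show ?thesis using insert by simp
  qed
  finally show ?case .
qed (simp add: order_0I)

text \<open>The diagonal entries are grouped by value: the fibre of \<open>u\<close> over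
  \<open>\<mu>\<close> has \<open>spectral_multiplicity \<mu> A\<close> elements. Entries of modulus
  at most 1 contribute \<open>ln 1 = 0\<close>, so the right-hand side needs no case
  distinction.\<close>

lemma eigenvalue_sum:
  fixes A :: "complex ^ 'n ^ 'n" and u :: "'n \<Rightarrow> complex"
  assumes c: "charpoly A = (\<Prod>i\<in>UNIV. [:- u i, 1:])"
  shows "(\<Sum>\<mu> | \<mu> \<in> eigenvalues A \<and> cmod \<mu> > 1. real (spectral_multiplicity \<mu> A) * ln (cmod \<mu>))
    = (\<Sum>i\<in>UNIV. ln (max 1 (cmod (u i))))"
proof -
  have ev: "eigenvalues A = range u"
    by (auto simp: eigenvalues_roots c poly_prod)
  let ?E = "{\<mu>. \<mu> \<in> eigenvalues A \<and> cmod \<mu> > 1}"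
  have fin: "finite ?E" unfolding ev by simp
  have "(\<Sum>\<mu>\<in>?E. real (spectral_multiplicity \<mu> A) * ln (cmod \<mu>))
      = (\<Sum>\<mu>\<in>?E. \<Sum>i | i \<in> UNIV \<and> u i = \<mu>. ln (cmod (u i)))"
    by (intro sum.cong) (auto simp: spectral_multiplicity_def c order_prod_linear)
  also have "\<dots> = (\<Sum>\<mu>\<in>?E. \<Sum>i | i \<in> {i. cmod (u i) > 1} \<and> u i = \<mu>. ln (cmod (u i)))"
    by (intro sum.cong) auto
  also have "\<dots> = (\<Sum>i | cmod (u i) > 1. ln (cmod (u i)))"
    by (rule sum.group[OF _ fin]) (auto simp: ev)
  also have "\<dots> = (\<Sum>i\<in>UNIV. ln (max 1 (cmod (u i))))"
    by (rule sum.mono_neutral_cong_left) (auto simp: max_def)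
  finally show ?thesis .
qed


section \<open>Counting integer points in orbit sums\<close>

text \<open>The Minkowski sum \<open>K + T K + ... + T^(n-1) K\<close>, called \<open>S_n\<close>
  above; for \<open>n = 0\<close> it is the empty sum.\<close>

primrec orbit_sums :: "int ^ 'n ^ 'n \<Rightarrow> (int ^ 'n) set \<Rightarrow> nat \<Rightarrow> (int ^ 'n) set" where
  "orbit_sums T K 0 = {0}"
| "orbit_sums T K (Suc n) = {x + ((*v) T ^^ n) k | x k. x \<in> orbit_sums T K n \<and> k \<in> K}"

lemma orbit_sums_Suc_image:
  "orbit_sums T K (Suc n) = (\<lambda>(x, k). x + ((*v) T ^^ n) k) ` (orbit_sums T K n \<times> K)"
  by auto

lemma finite_orbit_sums: "finite K \<Longrightarrow> finite (orbit_sums T K n)"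
  by (induction n) (auto simp: orbit_sums_Suc_image simp del: orbit_sums.simps(2))

lemma orbit_sums_nonempty: "K \<noteq> {} \<Longrightarrow> orbit_sums T K n \<noteq> {}"
  by (induction n) auto

definition of_int_vec :: "int ^ 'n \<Rightarrow> 'a::ring_1 ^ 'n" where
  "of_int_vec x = (\<chi> i. of_int (x $ i))"

definition of_int_matrix :: "int ^ 'n ^ 'n \<Rightarrow> 'a::comm_ring_1 ^ 'n ^ 'n" where
  "of_int_matrix T = (\<chi> i j. of_int (T $ i $ j))"

lemma of_int_vec_nth [simp]: "of_int_vec x $ i = of_int (x $ i)"
  by (simp add: of_int_vec_def)

lemma of_int_matrix_nth [simp]: "of_int_matrix T $ i $ j = of_int (T $ i $ j)"
  by (simp add: of_int_matrix_def)

lemma of_int_vec_add: "of_int_vec (x + y) = of_int_vec x + of_int_vec y"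
  and of_int_vec_diff: "of_int_vec (x - y) = of_int_vec x - of_int_vec y"
  and of_int_vec_0: "of_int_vec 0 = 0"
  by (simp_all add: vec_eq_iff)

lemma of_int_matrix_vector: "of_int_vec (T *v x) = of_int_matrix T *v of_int_vec x"
  by (simp add: vec_eq_iff matrix_vector_mult_def)

lemma of_int_matrix_funpow:
  "of_int_vec (((*v) T ^^ n) x) = ((*v) (of_int_matrix T) ^^ n) (of_int_vec x)"
  by (induction n) (simp_all add: of_int_matrix_vector)

lemma matpow_of_int_matrix: "matpow (of_int_matrix T) n = of_int_matrix (matpow T n)"
proof (induction n)
  case (Suc n)
  then show ?case by (simp add: matpow_Suc vec_eq_iff matrix_matrix_mult_def)
qed (simp add: matpow_0 vec_eq_iff mat_def)

lemma complex_matrix_eq: "complex_matrix T = of_int_matrix T"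
  by (simp add: complex_matrix_def of_int_matrix_def)

text \<open>Induction from the last coordinate in the order of \<open>r\<close> backwards: the
  coordinate \<open>i\<close> is multiplied by \<open>U $ i $ i\<close> and receives a contribution
  from the coordinates after \<open>i\<close>, which by \<open>sorted\<close> grow no faster than
  the rate claimed for \<open>i\<close>. The margin \<open>\<epsilon>\<close> absorbs that
  contribution.\<close>

lemma triangular_orbit_bound:
  fixes U :: "complex ^ 'n ^ 'n" and r :: "'n \<Rightarrow> nat"
  assumes U: "\<And>i j. r j < r i \<Longrightarrow> U $ i $ j = 0"
    and sorted: "\<And>i j. r i \<le> r j \<Longrightarrow> cmod (U $ j $ j) \<le> cmod (U $ i $ i)"
    and r: "inj r" and \<epsilon>: "\<epsilon> > 0"
    and y: "\<And>n. y (Suc n) = U *v y n"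
  shows "\<exists>C\<ge>0. \<forall>n. cmod (y n $ i) \<le> C * (max 1 (cmod (U $ i $ i)) + \<epsilon>) ^ n"
proof (induction i rule: measure_induct_rule[where f = "\<lambda>i. Max (range r) - r i"])
  case (less i)
  define R where "R i = max 1 (cmod (U $ i $ i)) + \<epsilon>" for i
  let ?J = "{j. r i < r j}"
  have "\<exists>C\<ge>0. \<forall>n. cmod (y n $ j) \<le> C * R j ^ n" if "j \<in> ?J" for j
  proof -
    have "r i < Max (range r)"
      using that Max_ge[of "range r" "r j"] by (auto intro: less_le_trans)
    then show ?thesis unfolding R_def using that by (intro less diff_less_mono2) auto
  qed
  then obtain C where C: "\<And>j. j \<in> ?J \<Longrightarrow> C j \<ge> 0"
      "\<And>j n. j \<in> ?J \<Longrightarrow> cmod (y n $ j) \<le> C j * R j ^ n"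
    by metis
  define D where "D = (\<Sum>j\<in>?J. cmod (U $ i $ j) * C j)"
  have D: "D \<ge> 0" unfolding D_def using C by (intro sum_nonneg) auto
  \<comment> \<open>Covers the initial value and gives \<open>D \<le> \<epsilon> * B\<close>, so one
    step costs at most the factor \<open>cmod (U $ i $ i) + \<epsilon>\<close>, which is at most
    \<open>R i\<close>.\<close>
  define B where "B = max (cmod (y 0 $ i)) (D / \<epsilon>)"
  have B: "B \<ge> 0" "cmod (y 0 $ i) \<le> B" "D \<le> \<epsilon> * B"
    using \<epsilon> D by (auto simp: B_def max_def field_simps split: if_splits)
  have R0: "R j \<ge> 0" for j unfolding R_def using \<epsilon> by simp
  have "cmod (y n $ i) \<le> B * R i ^ n" for n
  proof (induction n)
    case (Suc n)
    have "y (Suc n) $ i = (\<Sum>j\<in>UNIV. U $ i $ j * y n $ j)"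
      by (simp add: y matrix_vector_mult_def)
    also have "\<dots> = (\<Sum>j\<in>insert i ?J. U $ i $ j * y n $ j)"
    proof (rule sum.mono_neutral_right)
      show "\<forall>j\<in>UNIV - insert i ?J. U $ i $ j * y n $ j = 0"
        using U r by (auto simp: not_less le_less inj_eq)
    qed auto
    also have "\<dots> = U $ i $ i * y n $ i + (\<Sum>j\<in>?J. U $ i $ j * y n $ j)" by simp
    finally have "cmod (y (Suc n) $ i)
        \<le> cmod (U $ i $ i * y n $ i) + cmod (\<Sum>j\<in>?J. U $ i $ j * y n $ j)"
      by (simp add: norm_triangle_ineq)
    also have "\<dots> \<le> cmod (U $ i $ i) * cmod (y n $ i)
        + (\<Sum>j\<in>?J. cmod (U $ i $ j) * cmod (y n $ j))"
      using norm_sum[of "\<lambda>j. U $ i $ j * y n $ j" ?J] by (simp add: norm_mult)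
    also have "\<dots> \<le> cmod (U $ i $ i) * (B * R i ^ n) + (\<Sum>j\<in>?J. cmod (U $ i $ j) * (C j * R i ^ n))"
    proof (intro add_mono mult_left_mono sum_mono Suc)
      fix j assume j: "j \<in> ?J"
      have "C j * R j ^ n \<le> C j * R i ^ n"
        using sorted[of i j] j C(1)[OF j] R0
        by (intro mult_left_mono power_mono) (auto simp: R_def)
      with C(2)[OF j, of n] show "cmod (y n $ j) \<le> C j * R i ^ n" by simp
    qed auto
    also have "\<dots> = (cmod (U $ i $ i) * B + D) * R i ^ n"
      by (simp add: D_def sum_distrib_right distrib_right mult.assoc)
    also have "\<dots> \<le> (cmod (U $ i $ i) * B + \<epsilon> * B) * R i ^ n"
      using B R0 by (intro mult_right_mono add_mono) auto
    also have "\<dots> \<le> (R i * B) * R i ^ n"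
      using B R0 by (intro mult_right_mono) (auto simp: R_def algebra_simps intro!: mult_left_mono)
    finally show ?case by (simp add: mult_ac)
  qed (use B in simp)
  with B show ?case unfolding R_def by blast
qed

text \<open>By linearity in each row, the rows can be replaced one after the other by their real or imaginary
  parts without making the determinant vanish.\<close>

lemma real_rows_nonsingular:
  fixes Q :: "complex ^ 'n ^ 'n"
  assumes "det Q \<noteq> 0"
  obtains M :: "real ^ 'n ^ 'n"
    where "det M \<noteq> 0" "\<And>x i. \<bar>(M *v of_int_vec x) $ i\<bar> \<le> cmod ((Q *v of_int_vec x) $ i)"
proof -
  let ?row = "\<lambda>p i. (\<chi> j. complex_of_real (p (Q $ i $ j)))"
  have "\<exists>A. det A \<noteq> 0 \<and> (\<forall>i\<in>I. \<exists>p\<in>{Re, Im}. A $ i = ?row p i) \<and> (\<forall>i. i \<notin> I \<longrightarrow> A $ i = Q $ i)"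
    if "finite I" for I
    using that
  proof (induction I rule: finite_induct)
    case empty
    show ?case using assms by auto
  next
    case (insert k I)
    then obtain A where A: "det A \<noteq> 0" "\<forall>i\<in>I. \<exists>p\<in>{Re, Im}. A $ i = ?row p i"
        "\<forall>i. i \<notin> I \<longrightarrow> A $ i = Q $ i"
      by blast
    let ?A = "\<lambda>p. (\<chi> i. if i = k then ?row p i else A $ i) :: complex ^ 'n ^ 'n"
    have "A = (\<chi> i. if i = k then ?row Re i + \<i> *s ?row Im i else A $ i)"
      using A(3) insert(2) by (auto simp: vec_eq_iff complex_eq_iff)
    also have "det \<dots> = det (?A Re) + \<i> * det (?A Im)"
      using Determinants.det_row_add[of k "?row Re" "\<lambda>i. \<i> *s ?row Im i" "\<lambda>i. A $ i"]
        Determinants.det_row_mul[of k \<i> "?row Im" "\<lambda>i. A $ i"] by simp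
    finally have "det (?A Re) \<noteq> 0 \<or> det (?A Im) \<noteq> 0" using A(1) by auto
    then obtain p where p: "p \<in> {Re, Im}" "det (?A p) \<noteq> 0" by blast
    then show ?case using A insert(2) by (intro exI[of _ "?A p"]) auto
  qed
  from this[of UNIV] obtain A where A: "det A \<noteq> 0" "\<And>i. \<exists>p\<in>{Re, Im}. A $ i = ?row p i"
    by auto
  then obtain p where p: "\<And>i. p i \<in> {Re, Im}" "\<And>i. A $ i = ?row (p i) i" by metis
  define M :: "real ^ 'n ^ 'n" where "M = (\<chi> i j. p i (Q $ i $ j))"
  show thesis
  proof (rule that[of M])
    have "det A = complex_of_real (det M)"
      by (simp add: det_def M_def p(2))
    with A show "det M \<noteq> 0" by simp
    fix x :: "int ^ 'n" and i
    \<comment> \<open>Integer vectors are real, so the real-linear map \<open>p i\<close> passes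
      through the sum.\<close>
    have "(M *v of_int_vec x) $ i = p i ((Q *v of_int_vec x) $ i)"
      using p(1)[of i] by (auto simp: M_def matrix_vector_mult_def)
    then show "\<bar>(M *v of_int_vec x) $ i\<bar> \<le> cmod ((Q *v of_int_vec x) $ i)"
      using p(1)[of i] abs_Re_le_cmod abs_Im_le_cmod by auto
  qed
qed

lemma
  fixes A :: "'n::finite \<Rightarrow> int set"
  assumes "\<And>i. finite (A i)"
  shows finite_vec_box: "finite {v. \<forall>i. v $ i \<in> A i}"
    and card_vec_box: "card {v. \<forall>i. v $ i \<in> A i} = (\<Prod>i\<in>UNIV. card (A i))"
proof -
  have b: "bij_betw vec_nth {v. \<forall>i. v $ i \<in> A i} (PiE UNIV A)"
    by (rule bij_betw_byWitness[where f' = vec_lambda]) auto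
  show "finite {v. \<forall>i. v $ i \<in> A i}"
    using bij_betw_finite[OF b] finite_PiE[of UNIV A] assms by simp
  show "card {v. \<forall>i. v $ i \<in> A i} = (\<Prod>i\<in>UNIV. card (A i))"
    using bij_betw_same_card[OF b] by (simp add: card_PiE)
qed

text \<open>After scaling by a constant depending only on \<open>M\<close>, integer points are separated by the
  floors of the coordinates of \<open>M x\<close>.\<close>

lemma card_integer_points_le:
  fixes M :: "real ^ 'n ^ 'n"
  assumes "det M \<noteq> 0"
  obtains c where "c > 0"
    "\<And>S B. \<lbrakk>\<And>i. B i \<ge> 1; \<And>x i. x \<in> S \<Longrightarrow> \<bar>(M *v of_int_vec x) $ i\<bar> \<le> B i\<rbrakk>
      \<Longrightarrow> real (card S) \<le> c * (\<Prod>i\<in>UNIV. B i)"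
proof -
  obtain N where N: "N ** M = mat 1"
    using assms by (metis invertible_det_nz invertible_left_inverse)
  \<comment> \<open>\<open>c\<close> exceeds every absolute row sum of the inverse \<open>N\<close>.
    Hence an integer vector \<open>z\<close> for which \<open>M *v of_int_vec z\<close>, scaled by
    \<open>c\<close>, has coordinates of modulus at most 1 has coordinates of modulus below 1 and
    vanishes.\<close>
  define c where "c = 1 + (\<Sum>i\<in>UNIV. \<Sum>j\<in>UNIV. \<bar>N $ i $ j\<bar>)"
  have row: "(\<Sum>j\<in>UNIV. \<bar>N $ i $ j\<bar>) < c" for i
    using member_le_sum[of i UNIV "\<lambda>i. \<Sum>j\<in>UNIV. \<bar>N $ i $ j\<bar>"] by (simp add: c_def sum_nonneg)
  have c: "c > 0" unfolding c_def by (intro add_pos_nonneg sum_nonneg) auto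
  have sep: "z = 0" if z: "\<And>i. \<bar>c * (M *v of_int_vec z) $ i\<bar> \<le> 1" for z :: "int ^ 'n"
  proof -
    have "\<bar>z $ i\<bar> < 1" for i
    proof -
      let ?w = "M *v of_int_vec z"
      have "real_of_int (z $ i) = (N *v ?w) $ i" by (simp add: matrix_vector_mul_assoc N)
      also have "\<dots> = (\<Sum>j\<in>UNIV. N $ i $ j * ?w $ j)" by (simp add: matrix_vector_mult_def)
      finally have "\<bar>real_of_int (z $ i)\<bar> \<le> (\<Sum>j\<in>UNIV. \<bar>N $ i $ j\<bar> * \<bar>?w $ j\<bar>)"
        by (simp add: sum_abs[THEN order_trans] abs_mult)
      also have "\<dots> \<le> (\<Sum>j\<in>UNIV. \<bar>N $ i $ j\<bar> * (1 / c))"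
        using z c by (intro sum_mono mult_left_mono) (auto simp: abs_mult field_simps)
      also have "\<dots> = (\<Sum>j\<in>UNIV. \<bar>N $ i $ j\<bar>) / c" by (simp add: sum_divide_distrib)
      also have "\<dots> < 1" using row c by simp
      finally show ?thesis by linarith
    qed
    then show ?thesis by (simp add: vec_eq_iff)
  qed
  define \<phi> :: "int ^ 'n \<Rightarrow> int ^ 'n" where "\<phi> x = (\<chi> i. \<lfloor>c * (M *v of_int_vec x) $ i\<rfloor>)" for x
  have inj: "inj \<phi>"
  proof (rule injI)
    fix x y assume "\<phi> x = \<phi> y"
    then have f: "\<lfloor>c * (M *v of_int_vec x) $ i\<rfloor> = \<lfloor>c * (M *v of_int_vec y) $ i\<rfloor>" for i
      by (simp add: \<phi>_def vec_eq_iff)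
    have "\<bar>c * (M *v of_int_vec (x - y)) $ i\<bar> \<le> 1" for i
      using f[of i] by (simp add: of_int_vec_diff matrix_vector_mult_diff_distrib right_diff_distrib) linarith
    from sep[OF this] show "x = y" by simp
  qed
  show thesis
  \<comment> \<open>The floors lie in intervals \<open>{- m..m}\<close> with
    \<open>m \<le> c * B + 1\<close>, which contain at most
    \<open>2 * c * B + 3 \<le> (2 * c + 3) * B\<close> integers because
    \<open>B \<ge> 1\<close>.\<close>
  proof (rule that[of "(2 * c + 3) ^ CARD('n)"])
    show "(2 * c + 3) ^ CARD('n) > 0" using c by simp
    fix S :: "(int ^ 'n) set" and B :: "'n \<Rightarrow> real"
    assume B: "\<And>i. B i \<ge> 1" and S: "\<And>x i. x \<in> S \<Longrightarrow> \<bar>(M *v of_int_vec x) $ i\<bar> \<le> B i"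
    define m where "m i = \<lfloor>c * B i\<rfloor> + 1" for i
    let ?V = "{v :: int ^ 'n. \<forall>i. v $ i \<in> {- m i..m i}}"
    have m0: "m i \<ge> 0" for i using B[of i] c by (simp add: m_def)
    have "\<phi> x \<in> ?V" if "x \<in> S" for x
    proof -
      have "\<bar>c * (M *v of_int_vec x) $ i\<bar> \<le> c * B i" for i
        using S[OF that] c by (simp add: abs_mult)
      then have "\<lfloor>c * (M *v of_int_vec x) $ i\<rfloor> \<in> {- m i..m i}" for i
      proof -
        have "\<lfloor>c * (M *v of_int_vec x) $ i\<rfloor> \<le> m i"
        proof -
          from \<open>\<And>i. \<bar>c * (M *v of_int_vec x) $ i\<bar> \<le> c * B i\<close>[of i]
          have "c * (M *v of_int_vec x) $ i \<le> c * B i" by linarith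
          from floor_mono[OF this] show ?thesis by (simp add: m_def)
        qed
        moreover have "- m i \<le> \<lfloor>c * (M *v of_int_vec x) $ i\<rfloor>"
        proof -
          have "c * B i \<le> real_of_int (m i)" by (simp add: m_def)
          with \<open>\<And>i. \<bar>c * (M *v of_int_vec x) $ i\<bar> \<le> c * B i\<close>[of i]
          have "real_of_int (- m i) \<le> c * (M *v of_int_vec x) $ i" by linarith
          then show ?thesis by (simp only: le_floor_iff)
        qed
        ultimately show ?thesis by simp
      qed
      then show ?thesis by (simp add: \<phi>_def)
    qed
    then have "\<phi> ` S \<subseteq> ?V" by blast
    then have "card S \<le> card ?V"
      using card_mono[OF finite_vec_box \<open>\<phi> ` S \<subseteq> ?V\<close>] card_image[OF inj_on_subset[OF inj], of S]
      by simp
    also have "card ?V = (\<Prod>i\<in>UNIV. card {- m i..m i})" by (rule card_vec_box) simp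
    finally have "real (card S) \<le> (\<Prod>i\<in>UNIV. real (card {- m i..m i}))"
      unfolding of_nat_prod[symmetric] of_nat_le_iff .
    also have "\<dots> \<le> (\<Prod>i\<in>UNIV. (2 * c + 3) * B i)"
    proof (intro prod_mono conjI)
      fix i
      have "real_of_int (m i) \<le> c * B i + 1" by (simp add: m_def)
      then show "real (card {- m i..m i}) \<le> (2 * c + 3) * B i"
        using B[of i] m0[of i] by (simp add: algebra_simps)
    qed simp
    also have "\<dots> = (2 * c + 3) ^ CARD('n) * (\<Prod>i\<in>UNIV. B i)" by (simp add: prod.distrib)
    finally show "real (card S) \<le> (2 * c + 3) ^ CARD('n) * (\<Prod>i\<in>UNIV. B i)" .
  qed
qed

text \<open>In the coordinates given by \<open>Q\<close>, each summand of a point of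
  \<open>S_n\<close> is controlled by \<open>triangular_orbit_bound\<close>. Summing over the powers
  of \<open>T\<close> is a geometric series of ratio at least \<open>1 + \<epsilon>\<close> and
  costs only a factor of order \<open>1 / \<epsilon>\<close>. Passing to real coordinates then
  leaves integer points in a box to be counted.\<close>

lemma card_orbit_sums_le:
  fixes T :: "int ^ 'n ^ 'n" and r :: "'n \<Rightarrow> nat"
  assumes r: "inj r" and Q: "det Q \<noteq> 0" "Q ** complex_matrix T = U ** Q"
    and U: "\<And>i j. r j < r i \<Longrightarrow> U $ i $ j = 0"
    and sorted: "\<And>i j. r i \<le> r j \<Longrightarrow> cmod (U $ j $ j) \<le> cmod (U $ i $ i)"
    and K: "finite K" and \<epsilon>: "\<epsilon> > 0"
  obtains C where "C > 0"
    "\<And>n. real (card (orbit_sums T K n)) \<le> C * (\<Prod>i\<in>UNIV. max 1 (cmod (U $ i $ i)) + \<epsilon>) ^ n"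
proof -
  define R where "R i = max 1 (cmod (U $ i $ i)) + \<epsilon>" for i
  have R: "R i \<ge> 1 + \<epsilon>" for i by (simp add: R_def)
  define y :: "int ^ 'n \<Rightarrow> nat \<Rightarrow> complex ^ 'n" where "y k n = Q *v of_int_vec (((*v) T ^^ n) k)" for k n
  have "y k (Suc n) = U *v y k n" for k n
    by (simp add: y_def of_int_matrix_vector complex_matrix_eq[symmetric] matrix_vector_mul_assoc Q(2))
  then have "\<exists>C\<ge>0. \<forall>n. cmod (y k n $ i) \<le> C * R i ^ n" for k i
    unfolding R_def by (intro triangular_orbit_bound[where r = r] U sorted r \<epsilon>)
  then obtain C :: "int ^ 'n \<Rightarrow> 'n \<Rightarrow> real" where C0: "\<And>k i. C k i \<ge> 0" and C: "\<And>k i n. cmod (y k n $ i) \<le> C k i * R i ^ n"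
    by metis
  define D where "D = 1 + (\<Sum>k\<in>K. \<Sum>i\<in>UNIV. C k i)"
  have D1: "D \<ge> 1" unfolding D_def using C0 by (simp add: sum_nonneg)
  have CD: "C k i \<le> D" if "k \<in> K" for k i
  proof -
    have "C k i \<le> (\<Sum>i\<in>UNIV. C k i)" using C0 by (intro member_le_sum) auto
    also have "\<dots> \<le> (\<Sum>k\<in>K. \<Sum>i\<in>UNIV. C k i)"
      using that K C0 by (intro member_le_sum[of k K "\<lambda>k. \<Sum>i\<in>UNIV. C k i"] sum_nonneg) auto
    finally show ?thesis by (simp add: D_def)
  qed
  have sum_bound: "cmod ((Q *v of_int_vec x) $ i) \<le> D / \<epsilon> * R i ^ n" if "x \<in> orbit_sums T K n" for x i n
    using that
  proof (induction n arbitrary: x)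
    case 0
    then show ?case using D1 \<epsilon> by (simp add: of_int_vec_0)
  next
    case (Suc n)
    then obtain x' k where x: "x = x' + ((*v) T ^^ n) k" "x' \<in> orbit_sums T K n" "k \<in> K" by auto
    have "(Q *v of_int_vec x) $ i = (Q *v of_int_vec x') $ i + y k n $ i"
      by (simp add: x(1) y_def of_int_vec_add matrix_vector_right_distrib)
    then have "cmod ((Q *v of_int_vec x) $ i) \<le> D / \<epsilon> * R i ^ n + C k i * R i ^ n"
      using norm_triangle_mono[OF Suc.IH[OF x(2)] C] by simp
    also have "\<dots> \<le> D / \<epsilon> * R i ^ n + D * R i ^ n"
      using CD[OF x(3)] R[of i] \<epsilon> by (intro add_left_mono mult_right_mono) auto
    also have "\<dots> = D / \<epsilon> * (1 + \<epsilon>) * R i ^ n" using \<epsilon> by (simp add: field_simps)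
    also have "\<dots> \<le> D / \<epsilon> * R i * R i ^ n"
      using R[of i] \<epsilon> D1 by (intro mult_right_mono mult_left_mono) auto
    finally show ?case by simp
  qed
  obtain M :: "real ^ 'n ^ 'n" where M: "det M \<noteq> 0"
      "\<And>x i. \<bar>(M *v of_int_vec x) $ i\<bar> \<le> cmod ((Q *v of_int_vec x) $ i)"
    using real_rows_nonsingular[OF Q(1)] by blast
  obtain c where c: "c > 0" "\<And>S B. \<lbrakk>\<And>i. B i \<ge> 1; \<And>x i. x \<in> S \<Longrightarrow> \<bar>(M *v of_int_vec x) $ i\<bar> \<le> B i\<rbrakk>
      \<Longrightarrow> real (card S) \<le> c * (\<Prod>i\<in>UNIV. B i)"
    using card_integer_points_le[OF M(1)] by blast
  \<comment> \<open>The summand 1 makes every bound \<open>E * R i ^ n\<close> at least 1, as the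
    counting estimate requires.\<close>
  define E where "E = 1 + D / \<epsilon>"
  have E: "E \<ge> 1" using D1 \<epsilon> by (simp add: E_def)
  show thesis
  proof (rule that[of "c * E ^ CARD('n)"])
    show "c * E ^ CARD('n) > 0" using c E by simp
    fix n
    have "real (card (orbit_sums T K n)) \<le> c * (\<Prod>i\<in>UNIV. E * R i ^ n)"
    proof (rule c(2))
      fix i
      have "1 \<le> R i ^ n" using R[of i] \<epsilon> by (intro one_le_power) simp
      then have "1 * 1 \<le> E * R i ^ n" using E by (intro mult_mono) auto
      then show "1 \<le> E * R i ^ n" by simp
      fix x assume "x \<in> orbit_sums T K n"
      from M(2)[of x i] sum_bound[OF this, of i]
      have "\<bar>(M *v of_int_vec x) $ i\<bar> \<le> D / \<epsilon> * R i ^ n" by simp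
      also have "\<dots> \<le> E * R i ^ n" using \<open>1 \<le> R i ^ n\<close> by (intro mult_right_mono) (auto simp: E_def)
      finally show "\<bar>(M *v of_int_vec x) $ i\<bar> \<le> E * R i ^ n" .
    qed
    also have "\<dots> = c * E ^ CARD('n) * (\<Prod>i\<in>UNIV. R i) ^ n"
      by (simp add: prod.distrib prod_power_distrib)
    finally show "real (card (orbit_sums T K n))
        \<le> c * E ^ CARD('n) * (\<Prod>i\<in>UNIV. max 1 (cmod (U $ i $ i)) + \<epsilon>) ^ n"
      by (simp add: R_def)
  qed
qed


section \<open>Lower bound for orbit sums\<close>

text \<open>Conjugation by \<open>g\<close> is a sign-preserving bijection between the permutations
  of the two index types, so the Leibniz formulas agree term by term.\<close>

lemma det_reindex:
  fixes M :: "'a::comm_ring_1 ^ 'n ^ 'n" and g :: "'m::finite \<Rightarrow> 'n"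
  assumes g: "bij g"
  shows "det (\<chi> i j. M $ g i $ g j) = det M"
proof -
  let ?m = "map_permutation UNIV g"
  have inj: "inj g" and gU: "bij_betw g UNIV UNIV" using g by (auto simp: bij_def)
  have inv: "bij_betw (inv_into UNIV g) UNIV UNIV" using g by (simp add: bij_imp_bij_inv)
  have b: "bij_betw ?m {p. p permutes UNIV} {p. p permutes UNIV}"
  proof (rule bij_betw_byWitness[where f' = "map_permutation UNIV (inv_into UNIV g)"])
    show "\<forall>p\<in>{p. p permutes UNIV}. map_permutation UNIV (inv_into UNIV g) (?m p) = p"
      by (intro ballI map_permutation_compose_inv[OF gU]) (simp_all add: inj)
    show "\<forall>p\<in>{p. p permutes UNIV}. ?m (map_permutation UNIV (inv_into UNIV g) p) = p"
      by (intro ballI map_permutation_compose_inv[OF inv])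
        (simp_all add: surj_f_inv_f[OF bij_is_surj[OF g]])
  qed (use map_permutation_permutes[OF gU] map_permutation_permutes[OF inv] in auto)
  have "det M = (\<Sum>p | p permutes UNIV. of_int (sign (?m p)) * (\<Prod>i\<in>UNIV. M $ i $ ?m p i))"
    unfolding det_def by (rule sum.reindex_bij_betw[OF b, symmetric])
  also have "\<dots> = (\<Sum>p | p permutes UNIV. of_int (sign p) * (\<Prod>i\<in>UNIV. M $ g i $ g (p i)))"
  proof (intro sum.cong arg_cong2[where f = "(*)"] refl)
    fix p assume "p \<in> {p. p permutes (UNIV :: 'm set)}"
    then show "of_int (sign (?m p)) = (of_int (sign p) :: 'a)"
      by (simp add: sign_map_permutation inj)
    show "(\<Prod>i\<in>UNIV. M $ i $ ?m p i) = (\<Prod>i\<in>UNIV. M $ g i $ g (p i))"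
      by (subst prod.reindex_bij_betw[OF gU, symmetric]) (simp add: map_permutation_apply inj)
  qed
  finally show ?thesis by (simp add: det_def)
qed

text \<open>The library states the change of volume under linear maps only for well-ordered index types.\<close>

typedef 'a well_ordered = "UNIV :: 'a set" ..

definition enumeration :: "'a \<Rightarrow> nat" where "enumeration = (SOME f. inj f)"

lemma inj_enumeration: "inj (enumeration :: 'a::finite \<Rightarrow> nat)"
proof -
  obtain f :: "'a \<Rightarrow> nat" where "inj f"
    using finite_imp_inj_to_nat_seg[OF finite[of UNIV]] by blast
  then show ?thesis unfolding enumeration_def by (rule someI[where P = inj])
qed

instantiation well_ordered :: (finite) "{finite, wellorder}"
begin

definition less_eq_well_ordered :: "'a well_ordered \<Rightarrow> 'a well_ordered \<Rightarrow> bool" where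
  "x \<le> y \<longleftrightarrow> enumeration (Rep_well_ordered x) \<le> enumeration (Rep_well_ordered y)"

definition less_well_ordered :: "'a well_ordered \<Rightarrow> 'a well_ordered \<Rightarrow> bool" where
  "x < y \<longleftrightarrow> enumeration (Rep_well_ordered x) < enumeration (Rep_well_ordered y)"

instance
proof
  show "finite (UNIV :: 'a well_ordered set)"
    by (rule finite_imageD[of Rep_well_ordered]) (auto simp: inj_on_def Rep_well_ordered_inject)
  fix x y z :: "'a well_ordered"
  show "x < y \<longleftrightarrow> x \<le> y \<and> \<not> y \<le> x" "x \<le> x" "x \<le> y \<Longrightarrow> y \<le> z \<Longrightarrow> x \<le> z" "x \<le> y \<or> y \<le> x"
    by (auto simp: less_eq_well_ordered_def less_well_ordered_def)
  show "x \<le> y \<Longrightarrow> y \<le> x \<Longrightarrow> x = y"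
    unfolding less_eq_well_ordered_def Rep_well_ordered_inject[symmetric, of x y]
    using inj_enumeration by (meson injD order_antisym)
next
  fix P :: "'a well_ordered \<Rightarrow> bool" and a :: "'a well_ordered"
  assume step: "\<And>x. (\<And>y. y < x \<Longrightarrow> P y) \<Longrightarrow> P x"
  show "P a"
  proof (induction a rule: measure_induct_rule[where f = "\<lambda>x. enumeration (Rep_well_ordered x)"])
    case (less x)
    show ?case by (rule step, rule less) (simp only: less_well_ordered_def)
  qed
qed

end

text \<open>The image of the unit cube has volume \<open>\<bar>det M\<bar>\<close> and is covered by
  the unit cubes whose lower corners lie in \<open>F\<close>.\<close>

lemma abs_det_le_card_floors_wellorder:
  fixes M :: "real ^ 'n::{finite,wellorder} ^ 'n::{finite,wellorder}"
  assumes F: "finite F"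
    and floors: "\<And>b. (\<And>i. 0 \<le> b $ i \<and> b $ i \<le> 1) \<Longrightarrow> (\<chi> i. \<lfloor>(M *v b) $ i\<rfloor>) \<in> F"
  shows "\<bar>det M\<bar> \<le> real (card F)"
proof -
  let ?I = "cbox 0 1 :: (real ^ 'n::_) set"
  let ?C = "\<lambda>x. cbox (of_int_vec x) (of_int_vec x + 1) :: (real ^ 'n::_) set"
  have content: "measure lebesgue (cbox a (a + 1)) = 1" for a :: "real ^ 'n::_"
  proof -
    have "cbox a (a + 1) \<noteq> {}" by (auto simp: interval_eq_empty_cart)
    from content_cbox_cart[OF this] show ?thesis by simp
  qed
  have "(*v) M ` ?I \<subseteq> (\<Union>x\<in>F. ?C x)"
  proof clarify
    fix b :: "real ^ 'n::_" assume "b \<in> ?I"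
    then have "(\<chi> i. \<lfloor>(M *v b) $ i\<rfloor>) \<in> F" by (intro floors) (simp add: mem_box_cart)
    moreover have "M *v b \<in> ?C (\<chi> i. \<lfloor>(M *v b) $ i\<rfloor>)"
      by (simp add: mem_box_cart)
    ultimately show "M *v b \<in> (\<Union>x\<in>F. ?C x)" by blast
  qed
  then have "measure lebesgue ((*v) M ` ?I) \<le> measure lebesgue (\<Union>x\<in>F. ?C x)"
    by (rule measure_mono_fmeasurable)
      (intro fmeasurableD measurable_linear_image fmeasurable.finite_UN[OF F]
        matrix_vector_mul_linear lmeasurable_cbox)+
  also have "\<dots> \<le> (\<Sum>x\<in>F. measure lebesgue (?C x))"
    using F by (intro measure_UNION_le) auto
  also have "\<dots> = real (card F)" by (simp add: content)
  also have "measure lebesgue ((*v) M ` ?I) = \<bar>det M\<bar>"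
    using content[of 0] by (subst measure_linear_image) auto
  finally show ?thesis .
qed

text \<open>Relabelling the coordinates along \<open>Rep_well_ordered\<close> keeps the determinant,
  by \<open>det_reindex\<close>, and does not increase the number of floor vectors.\<close>

lemma abs_det_le_card_floors:
  fixes M :: "real ^ 'n ^ 'n"
  assumes F: "finite F"
    and floors: "\<And>b. (\<And>i. 0 \<le> b $ i \<and> b $ i \<le> 1) \<Longrightarrow> (\<chi> i. \<lfloor>(M *v b) $ i\<rfloor>) \<in> F"
  shows "\<bar>det M\<bar> \<le> real (card F)"
proof -
  let ?g = "Rep_well_ordered :: 'n well_ordered \<Rightarrow> 'n"
  have g: "bij ?g"
    by (rule bij_betw_byWitness[where f' = Abs_well_ordered])
      (auto simp: Rep_well_ordered_inverse Abs_well_ordered_inverse)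
  have gA: "?g (Abs_well_ordered i) = i" and Ag: "Abs_well_ordered (?g k) = k" for i k
    by (simp_all add: Rep_well_ordered_inverse Abs_well_ordered_inverse)
  let ?M = "(\<chi> i j. M $ ?g i $ ?g j) :: real ^ 'n well_ordered ^ 'n well_ordered"
  let ?r = "\<lambda>x :: int ^ 'n. (\<chi> i. x $ ?g i) :: int ^ 'n well_ordered"
  have "\<bar>det ?M\<bar> \<le> real (card (?r ` F))"
  proof (rule abs_det_le_card_floors_wellorder)
    show "finite (?r ` F)" using F by simp
    fix b :: "real ^ 'n well_ordered" assume b: "\<And>i. 0 \<le> b $ i \<and> b $ i \<le> 1"
    let ?b = "(\<chi> i. b $ Abs_well_ordered i) :: real ^ 'n"
    have "(?M *v b) $ k = (M *v ?b) $ ?g k" for k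
    proof -
      have "(M *v ?b) $ ?g k = (\<Sum>j\<in>UNIV. M $ ?g k $ j * b $ Abs_well_ordered j)"
        by (simp add: matrix_vector_mult_def)
      also have "\<dots> = (\<Sum>j\<in>UNIV. M $ ?g k $ ?g j * b $ Abs_well_ordered (?g j))"
        by (rule sum.reindex_bij_betw[OF g, symmetric])
      finally show ?thesis by (simp add: matrix_vector_mult_def Ag)
    qed
    then have "(\<chi> i. \<lfloor>(?M *v b) $ i\<rfloor>) = ?r (\<chi> i. \<lfloor>(M *v ?b) $ i\<rfloor>)" by simp
    moreover have "(\<chi> i. \<lfloor>(M *v ?b) $ i\<rfloor>) \<in> F" using b by (intro floors) simp
    ultimately show "(\<chi> i. \<lfloor>(?M *v b) $ i\<rfloor>) \<in> ?r ` F" by blast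
  qed
  also have "\<dots> \<le> real (card F)" using F by (simp add: card_image_le)
  finally show ?thesis by (simp add: det_reindex[OF g])
qed

section \<open>Rounding real points into orbit sums\<close>

definition int_box :: "int \<Rightarrow> (int ^ 'n) set" where
  "int_box m = {k. \<forall>i. k $ i \<in> {- m..m}}"

lemma finite_int_box: "finite (int_box m :: (int ^ 'n) set)"
  unfolding int_box_def by (rule finite_vec_box) simp

text \<open>Rounding \<open>b\<close> leaves a remainder in the unit cube, whose image under \<open>T\<close> is bounded and is carried
  over to the previous power of \<open>T\<close>.\<close>

lemma rounding_orbit_sums:
  fixes T :: "int ^ 'n ^ 'n" and m :: int
  assumes m: "real_of_int m \<ge> 2 + (\<Sum>i\<in>UNIV. \<Sum>j\<in>UNIV. real_of_int \<bar>T $ i $ j\<bar>)"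
    and x: "of_int_vec x = a + ((*v) (of_int_matrix T) ^^ n) b"
    and a: "\<And>i. \<bar>a $ i\<bar> \<le> (1::real)" and b: "\<And>i. \<bar>b $ i\<bar> \<le> real_of_int m - 1"
  shows "x \<in> orbit_sums T (int_box m) (Suc n)"
  using x b
proof (induction n arbitrary: x b)
  case 0
  \<comment> \<open>The bounds 1 for \<open>a\<close> and \<open>m - 1\<close> for \<open>b\<close>
    add up to \<open>m\<close>.\<close>
  have "\<bar>x $ i\<bar> \<le> m" for i
  proof -
    have "real_of_int (x $ i) = a $ i + b $ i" using 0(1) by (simp add: vec_eq_iff)
    with a[of i] 0(2)[of i] show ?thesis by linarith
  qed
  then have "x \<in> int_box m" by (simp add: int_box_def abs_le_iff minus_le_iff)
  then show ?case by simp
next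
  case (Suc n)
  let ?T = "of_int_matrix T :: real ^ 'n ^ 'n"
  define k :: "int ^ 'n" where "k = (\<chi> i. \<lfloor>b $ i\<rfloor>)"
  define f where "f = b - of_int_vec k"
  have f: "0 \<le> f $ i \<and> f $ i \<le> 1" for i
    by (simp add: f_def k_def) linarith
  have k: "k \<in> int_box m"
    unfolding int_box_def
  proof (intro CollectI allI)
    fix i
    have "b $ i < real_of_int m + 1" "real_of_int (- m) \<le> b $ i" using Suc.prems(2)[of i] by linarith+
    then show "k $ i \<in> {- m..m}" by (simp add: k_def floor_le_iff le_floor_iff)
  qed
  have lin: "((*v) ?T ^^ n) (u + v) = ((*v) ?T ^^ n) u + ((*v) ?T ^^ n) v" for u v n
    by (induction n) (simp_all add: matrix_vector_right_distrib)
  have "of_int_vec (x - ((*v) T ^^ Suc n) k) = a + ((*v) ?T ^^ Suc n) (of_int_vec k + f) - ((*v) ?T ^^ Suc n) (of_int_vec k)"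
    by (simp only: of_int_vec_diff of_int_matrix_funpow Suc.prems(1) f_def) simp
  also have "\<dots> = a + ((*v) ?T ^^ n) (?T *v f)"
    unfolding lin by (simp add: funpow_swap1)
  finally have "x - ((*v) T ^^ Suc n) k \<in> orbit_sums T (int_box m) (Suc n)"
  proof (rule Suc.IH)
    \<comment> \<open>Here the choice of \<open>m\<close> enters: a coordinate of the carried vector
      is at most an absolute row sum of \<open>T\<close>, hence at most
      \<open>m - 2\<close>.\<close>
    fix i
    have "\<bar>(?T *v f) $ i\<bar> \<le> (\<Sum>j\<in>UNIV. real_of_int \<bar>T $ i $ j\<bar> * \<bar>f $ j\<bar>)"
      by (simp add: matrix_vector_mult_def sum_abs[THEN order_trans] abs_mult)
    also have "\<dots> \<le> (\<Sum>j\<in>UNIV. real_of_int \<bar>T $ i $ j\<bar>)"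
      using f by (intro sum_mono mult_left_le) auto
    also have "\<dots> \<le> (\<Sum>i\<in>UNIV. \<Sum>j\<in>UNIV. real_of_int \<bar>T $ i $ j\<bar>)"
      by (intro member_le_sum[of i UNIV "\<lambda>i. \<Sum>j\<in>UNIV. real_of_int \<bar>T $ i $ j\<bar>"] sum_nonneg) auto
    finally show "\<bar>(?T *v f) $ i\<bar> \<le> real_of_int m - 1" using m by linarith
  qed
  with k show ?case
    unfolding orbit_sums.simps(2)[of _ _ "Suc n"] by (intro CollectI exI[of _ k] exI[of _ "x - ((*v) T ^^ Suc n) k"]) auto
qed

text \<open>For each of the \<open>d\<close> indices, at most one of the \<open>d + 1\<close> points \<open>0, 1/d, \<dots>, 1\<close> violates the bound.\<close>

lemma exists_shift_bounded_below:
  fixes u :: "'n::finite \<Rightarrow> complex"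
  obtains t :: real where "0 \<le> t" "t \<le> 1"
    "\<And>i. cmod (of_real t + u i) \<ge> 1 / (4 * real CARD('n)) * max 1 (cmod (u i))"
proof -
  let ?d = "CARD('n)"
  \<comment> \<open>With this \<open>e\<close>, two violations at the same index would put their two
    points at distance below \<open>4 * e = 1 / d\<close>, the spacing of the grid.\<close>
  define e where "e = 1 / (4 * real ?d)"
  have d: "real ?d \<ge> 1" by (simp add: Suc_le_eq)
  then have e: "0 < e" "e \<le> 1 / 4" by (auto simp: e_def field_simps)
  define t where "t j = real j / real ?d" for j
  have "\<exists>j\<in>{..?d}. \<forall>i. cmod (of_real (t j) + u i) \<ge> e * max 1 (cmod (u i))"
  proof (rule ccontr)
    assume "\<not> ?thesis"
    then have "\<forall>j\<in>{..?d}. \<exists>i. cmod (of_real (t j) + u i) < e * max 1 (cmod (u i))"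
      by (simp add: not_le)
    from bchoice[OF this] obtain g where
      g: "\<And>j. j \<in> {..?d} \<Longrightarrow> cmod (of_real (t j) + u (g j)) < e * max 1 (cmod (u (g j)))"
      by blast
    have "\<not> inj_on g {..?d}"
      using card_inj_on_le[of g "{..?d}" UNIV] by auto
    then obtain j k where jk: "j \<in> {..?d}" "k \<in> {..?d}" "j \<noteq> k" "g j = g k" by (auto simp: inj_on_def)
    let ?u = "u (g j)"
    have tj: "0 \<le> t j" "t j \<le> 1" using jk(1) d by (auto simp: t_def field_simps)
    \<comment> \<open>Since \<open>t j \<le> 1\<close>, a violation confines \<open>?u\<close> to
      modulus below 2, which turns the relative bound into the absolute bound
      \<open>2 * e\<close>.\<close>
    have "cmod ?u \<le> cmod (of_real (t j) + ?u) + cmod (of_real (t j))"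
      using norm_triangle_ineq4[of "of_real (t j) + ?u" "of_real (t j)"] by simp
    then have "cmod ?u \<le> e * max 1 (cmod ?u) + 1" using g[OF jk(1)] tj by simp
    moreover have "e * max 1 (cmod ?u) \<le> 1 / 4 * max 1 (cmod ?u)" using e by (intro mult_right_mono) auto
    ultimately have u2: "max 1 (cmod ?u) < 2" by linarith
    have "\<bar>t j - t k\<bar> = cmod ((of_real (t j) + ?u) - (of_real (t k) + ?u))"
      by (simp add: of_real_diff[symmetric] del: of_real_diff)
    also have "\<dots> \<le> cmod (of_real (t j) + ?u) + cmod (of_real (t k) + ?u)" by (rule norm_triangle_ineq4)
    also have "\<dots> < e * max 1 (cmod ?u) + e * max 1 (cmod ?u)"
      using g[OF jk(1)] g[OF jk(2)] jk(4) by simp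
    also have "\<dots> \<le> 4 * e" using u2 e by (simp add: mult.commute)
    also have "\<dots> = 1 / real ?d" by (simp add: e_def)
    finally have "\<bar>real j - real k\<bar> < 1" using d by (simp add: t_def diff_divide_distrib[symmetric] divide_less_cancel)
    with jk(3) show False by linarith
  qed
  then obtain j where j: "j \<le> ?d" "\<And>i. cmod (of_real (t j) + u i) \<ge> e * max 1 (cmod (u i))" by auto
  show thesis
    by (rule that[of "t j"]) (use j d in \<open>auto simp: e_def t_def field_simps\<close>)
qed

text \<open>The shift \<open>t\<close> is chosen anew for each \<open>n\<close>, while
  \<open>m\<close> and \<open>c\<close> stay fixed. Rounding places the floor of every point of
  \<open>(t + T^n) [0,1]^d\<close> in the orbit sum, where \<open>Suc n\<close> accounts for the
  powers \<open>0, ..., n\<close>, and the number of floors is at least the volume.\<close>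

lemma card_orbit_sums_ge:
  fixes T :: "int ^ 'n ^ 'n" and r :: "'n \<Rightarrow> nat"
  assumes r: "inj r" and Q: "det Q \<noteq> 0" "Q ** complex_matrix T = U ** Q"
    and U: "\<And>i j. r j < r i \<Longrightarrow> U $ i $ j = 0"
  obtains m c where "c > 0"
    "\<And>n. c * (\<Prod>i\<in>UNIV. max 1 (cmod (U $ i $ i))) ^ n \<le> real (card (orbit_sums T (int_box m) (Suc n)))"
proof -
  define s where "s = (\<Sum>i\<in>UNIV. \<Sum>j\<in>UNIV. real_of_int \<bar>T $ i $ j\<bar>)"
  have s: "s \<ge> 0" unfolding s_def by (intro sum_nonneg) auto
  define m where "m = \<lceil>s\<rceil> + 2"
  have m: "real_of_int m \<ge> 2 + s" by (simp add: m_def)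
  define c where "c = 1 / (4 * real CARD('n))"
  have c: "c > 0" by (simp add: c_def)
  show thesis
  proof (rule that[of "c ^ CARD('n)" m])
    show "c ^ CARD('n) > 0" using c by simp
    fix n
    obtain t :: real where t: "0 \<le> t" "t \<le> 1"
        "\<And>i. cmod (of_real t + (U $ i $ i) ^ n) \<ge> c * max 1 (cmod ((U $ i $ i) ^ n))"
      using exists_shift_bounded_below[of "\<lambda>i. (U $ i $ i) ^ n"] unfolding c_def by blast
    let ?M = "mat t + matpow (of_int_matrix T) n :: real ^ 'n ^ 'n"
    have "\<bar>det ?M\<bar> \<le> real (card (orbit_sums T (int_box m) (Suc n)))"
    proof (rule abs_det_le_card_floors)
      show "finite (orbit_sums T (int_box m) (Suc n))" by (intro finite_orbit_sums finite_int_box)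
      fix b :: "real ^ 'n" assume b: "\<And>i. 0 \<le> b $ i \<and> b $ i \<le> 1"
      let ?x = "(\<chi> i. \<lfloor>(?M *v b) $ i\<rfloor>) :: int ^ 'n"
      \<comment> \<open>\<open>?a\<close> is \<open>t *s b\<close> minus the fractional part of
        \<open>?M *v b\<close>: a difference of two vectors in the unit cube, hence at most 1 in
        every coordinate.\<close>
      let ?a = "t *s b - (?M *v b - of_int_vec ?x)"
      have mat: "mat t *v b = t *s b"
        by (simp add: vec_eq_iff matrix_vector_mult_def mat_def if_distrib[of "\<lambda>x. x * _"] cong: if_cong)
      have add: "?M *v b = mat t *v b + matpow (of_int_matrix T) n *v b"
        by (simp add: matrix_vector_mult_add_rdistrib)
      show "?x \<in> orbit_sums T (int_box m) (Suc n)"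
      proof (rule rounding_orbit_sums)
        show "2 + (\<Sum>i\<in>UNIV. \<Sum>j\<in>UNIV. real_of_int \<bar>T $ i $ j\<bar>) \<le> real_of_int m"
          using m by (simp add: s_def)
        show "of_int_vec ?x = ?a + ((*v) (of_int_matrix T) ^^ n) b"
          unfolding add mat matpow_vector by simp
        fix i
        have "0 \<le> t * b $ i" "t * b $ i \<le> 1" using t(1,2) b[of i] by (auto intro: mult_le_one)
        moreover have "0 \<le> (?M *v b) $ i - \<lfloor>(?M *v b) $ i\<rfloor>" "(?M *v b) $ i - \<lfloor>(?M *v b) $ i\<rfloor> \<le> 1"
          by linarith+
        ultimately show "\<bar>?a $ i\<bar> \<le> 1"
          by (simp only: vector_minus_component vector_smult_component of_int_vec_nth vec_lambda_beta)
        show "\<bar>b $ i\<bar> \<le> real_of_int m - 1" using b[of i] m s by simp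
      qed
    qed
    \<comment> \<open>The real determinant is evaluated over the complex numbers, where the
      triangular form factors it.\<close>
    moreover have "complex_of_real (det ?M) = det (mat (of_real t) + matpow (complex_matrix T) n)"
      unfolding det_def complex_matrix_eq matpow_of_int_matrix
      by (simp add: mat_def if_distrib[of complex_of_real] cong: if_cong)
    then have "complex_of_real (det ?M) = (\<Prod>i\<in>UNIV. of_real t + (U $ i $ i) ^ n)"
      using det_mat_plus_matpow[OF r Q U, of "of_real t" n] by (rule trans)
    then have "\<bar>det ?M\<bar> = cmod (\<Prod>i\<in>UNIV. of_real t + (U $ i $ i) ^ n)"
      by (metis norm_of_real)
    ultimately have "(\<Prod>i\<in>UNIV. cmod (of_real t + (U $ i $ i) ^ n))
        \<le> real (card (orbit_sums T (int_box m) (Suc n)))"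
      by (simp only: prod_norm)
    moreover have "c ^ CARD('n) * (\<Prod>i\<in>UNIV. max 1 (cmod (U $ i $ i))) ^ n
        = (\<Prod>i\<in>UNIV. c * max 1 (cmod (U $ i $ i)) ^ n)"
      by (simp add: prod.distrib prod_power_distrib)
    moreover have "\<dots> \<le> (\<Prod>i\<in>UNIV. cmod (of_real t + (U $ i $ i) ^ n))"
    proof (intro prod_mono conjI)
      fix i
      have "max 1 (cmod (U $ i $ i)) ^ n = max 1 (cmod ((U $ i $ i) ^ n))"
        using power_le_one[of "cmod (U $ i $ i)" n] one_le_power[of "cmod (U $ i $ i)" n]
        by (cases "cmod (U $ i $ i) \<le> 1") (simp_all add: norm_power max.absorb1 max.absorb2)
      with t(3)[of i] show "c * max 1 (cmod (U $ i $ i)) ^ n \<le> cmod (of_real t + (U $ i $ i) ^ n)" by simp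
    qed (use c in simp)
    ultimately show "c ^ CARD('n) * (\<Prod>i\<in>UNIV. max 1 (cmod (U $ i $ i))) ^ n
        \<le> real (card (orbit_sums T (int_box m) (Suc n)))"
      by linarith
  qed
qed


section \<open>Approximation by finite-dimensional subspaces\<close>

text \<open>\<open>p\<close> is the orthogonal projection of \<open>x\<close> onto the span of
  \<open>D\<close>. The second claim is Pythagoras for \<open>x = (x - p) + p\<close>; it yields
  Bessel's inequality and, when \<open>x\<close> is close to the span, a lower bound for the sum of
  squares.\<close>

lemma
  fixes D :: "'v::real_inner set" and x :: 'v
  assumes fin: "finite D" and orth: "pairwise orthogonal D" and unit: "\<And>c. c \<in> D \<Longrightarrow> norm c = 1"
  defines "p \<equiv> \<Sum>c\<in>D. (x \<bullet> c) *\<^sub>R c"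
  shows orthonormal_span: "z \<in> span D \<Longrightarrow> (x - p) \<bullet> z = 0"
    and orthonormal_sum_squares: "(\<Sum>c\<in>D. (x \<bullet> c)\<^sup>2) = (norm x)\<^sup>2 - (norm (x - p))\<^sup>2"
proof -
  have inner: "p \<bullet> c = x \<bullet> c" if "c \<in> D" for c
  proof -
    have "p \<bullet> c = (\<Sum>d\<in>D. (x \<bullet> d) * (d \<bullet> c))" by (simp add: p_def inner_sum_left)
    also have "\<dots> = (\<Sum>d\<in>{c}. (x \<bullet> d) * (d \<bullet> c))"
      using that fin orth by (intro sum.mono_neutral_right) (auto simp: pairwise_def orthogonal_def)
    also have "\<dots> = x \<bullet> c" using unit[OF that] by (simp add: dot_square_norm)
    finally show ?thesis .
  qed
  have orth_span: "(x - p) \<bullet> z = 0" if "z \<in> span D" for z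
    using that
  proof (induction rule: span_induct)
    case base
    show ?case by (auto simp: Real_Vector_Spaces.subspace_def inner_add_right)
  next
    case (step c)
    then show ?case by (simp add: inner_diff_left inner)
  qed
  then show "z \<in> span D \<Longrightarrow> (x - p) \<bullet> z = 0" .
  have "p \<in> span D" unfolding p_def by (intro span_sum span_scale span_base)
  then have "orthogonal (x - p) p" using orth_span by (simp add: orthogonal_def)
  then have "(norm x)\<^sup>2 = (norm (x - p))\<^sup>2 + (norm p)\<^sup>2"
    using norm_add_Pythagorean[of "x - p" p] by simp
  moreover have "(norm p)\<^sup>2 = (\<Sum>c\<in>D. (x \<bullet> c)\<^sup>2)"
  proof -
    have "(norm p)\<^sup>2 = p \<bullet> (\<Sum>c\<in>D. (x \<bullet> c) *\<^sub>R c)"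
      unfolding p_def[symmetric] by (simp add: dot_square_norm)
    also have "\<dots> = (\<Sum>c\<in>D. (x \<bullet> c)\<^sup>2)"
      by (simp add: inner_sum_right inner power2_eq_square)
    finally show ?thesis .
  qed
  ultimately show "(\<Sum>c\<in>D. (x \<bullet> c)\<^sup>2) = (norm x)\<^sup>2 - (norm (x - p))\<^sup>2" by simp
qed

text \<open>An orthogonal basis, from which zero is discarded before normalising.\<close>

lemma exists_orthonormal_spanning:
  fixes V :: "'v::real_inner set"
  assumes "finite V"
  obtains D where "finite D" "card D \<le> card V" "pairwise orthogonal D" "\<And>c. c \<in> D \<Longrightarrow> norm c = 1"
    "span V \<subseteq> span D"
proof -
  obtain C where C: "finite C" "card C \<le> card V" "span C = span V" "pairwise orthogonal C"
    using basis_orthogonal[OF assms] by blast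
  let ?D = "sgn ` (C - {0})"
  show thesis
  proof (rule that[of ?D])
    show "finite ?D" using C by simp
    have "card ?D \<le> card (C - {0})" using C by (intro card_image_le) simp
    also have "\<dots> \<le> card C" using C by (intro card_mono) auto
    finally show "card ?D \<le> card V" using C by simp
    show "pairwise orthogonal ?D"
      using C(4) by (auto simp: pairwise_def orthogonal_def sgn_div_norm)
    show "norm c = 1" if "c \<in> ?D" for c using that by (auto simp: norm_sgn split: if_splits)
    have "c \<in> span ?D" if "c \<in> C" for c
    proof (cases "c = 0")
      case False
      then have "c = norm c *\<^sub>R sgn c" by (simp add: sgn_div_norm)
      moreover have "norm c *\<^sub>R sgn c \<in> span ?D" using that False by (intro span_scale span_base) auto
      ultimately show ?thesis by simp
    qed (simp add: span_zero)
    then show "span V \<subseteq> span ?D"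
      unfolding C(3)[symmetric] by (intro span_minimal subspace_span) auto
  qed
qed

text \<open>Compare the trace of the orthogonal projection onto \<open>span V\<close> with the dimension of that space.\<close>

lemma card_orthonormal_approx:
  fixes e :: "'i \<Rightarrow> 'v::real_inner"
  assumes S: "finite S" and e: "\<And>s t. s \<in> S \<Longrightarrow> t \<in> S \<Longrightarrow> e s \<bullet> e t = (if s = t then 1 else 0)"
    and V: "finite V" and approx: "\<And>s. s \<in> S \<Longrightarrow> \<exists>z\<in>span V. norm (e s - z) < 1 / 2"
  shows "3 * real (card S) \<le> 4 * real (card V)"
proof -
  obtain D where D: "finite D" "card D \<le> card V" "pairwise orthogonal D" "\<And>c. c \<in> D \<Longrightarrow> norm c = 1"
      "span V \<subseteq> span D"
    using exists_orthonormal_spanning[OF V] by blast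
  have ge: "3 / 4 \<le> (\<Sum>c\<in>D. (e s \<bullet> c)\<^sup>2)" if s: "s \<in> S" for s
  proof -
    obtain z where z: "z \<in> span D" "norm (e s - z) < 1 / 2" using approx[OF s] D(5) by blast
    \<comment> \<open>The projection \<open>?p\<close> is at least as close to \<open>e s\<close> as
      \<open>z\<close>, so the squared distance is at most 1/4 and at least 3/4 of the squared norm
      lies in the projection.\<close>
    let ?p = "\<Sum>c\<in>D. (e s \<bullet> c) *\<^sub>R c"
    have "?p \<in> span D" by (intro span_sum span_scale span_base)
    then have "?p - z \<in> span D" using z by (intro span_diff)
    then have "orthogonal (e s - ?p) (?p - z)"
      using orthonormal_span[OF D(1,3,4)] by (simp add: orthogonal_def)
    from norm_add_Pythagorean[OF this]
    have "(norm (e s - ?p))\<^sup>2 \<le> (norm (e s - z))\<^sup>2" by simp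
    also have "\<dots> \<le> (1 / 2)\<^sup>2" using z by (intro power_mono) auto
    finally have "(norm (e s - ?p))\<^sup>2 \<le> 1 / 4" by (simp add: power2_eq_square)
    moreover have "(norm (e s))\<^sup>2 = 1" using e[OF s s] by (simp add: dot_square_norm[symmetric])
    ultimately show ?thesis using orthonormal_sum_squares[OF D(1,3,4), of "e s"] by simp
  qed
  have inj: "inj_on e S"
  proof (rule inj_onI, rule ccontr)
    fix s t assume "s \<in> S" "t \<in> S" "e s = e t" "s \<noteq> t"
    with e[of s s] e[of s t] show False by simp
  qed
  have "pairwise orthogonal (e ` S)"
    using e by (auto simp: pairwise_def orthogonal_def)
  moreover have "norm c = 1" if "c \<in> e ` S" for c
    using that e by (auto simp: norm_eq_sqrt_inner)
  ultimately have "(\<Sum>d\<in>e ` S. (c \<bullet> d)\<^sup>2) \<le> (norm c)\<^sup>2" for c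
    using orthonormal_sum_squares[of "e ` S" c] S by simp
  then have bessel: "(\<Sum>s\<in>S. (e s \<bullet> c)\<^sup>2) \<le> (norm c)\<^sup>2" for c
    by (simp add: sum.reindex[OF inj] inner_commute)
  \<comment> \<open>The double sum is at least 3/4 for each \<open>s\<close> and, by Bessel's
    inequality, at most 1 for each \<open>c\<close>.\<close>
  have "3 / 4 * real (card S) = (\<Sum>s\<in>S. 3 / 4)" by simp
  also have "\<dots> \<le> (\<Sum>s\<in>S. \<Sum>c\<in>D. (e s \<bullet> c)\<^sup>2)" using ge by (intro sum_mono)
  also have "\<dots> = (\<Sum>c\<in>D. \<Sum>s\<in>S. (e s \<bullet> c)\<^sup>2)" by (rule sum.swap)
  also have "\<dots> \<le> (\<Sum>c\<in>D. 1)"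
  proof (rule sum_mono)
    fix c assume "c \<in> D"
    then show "(\<Sum>s\<in>S. (e s \<bullet> c)\<^sup>2) \<le> 1" using bessel[of c] D(4)[of c] by simp
  qed
  also have "\<dots> = real (card D)" by simp
  finally show ?thesis using D(2) by simp
qed

section \<open>Operators evaluated at the basis vector at 0\<close>

lift_definition ell2_delta :: "'g \<Rightarrow> 'g ell2" is "\<lambda>g x. if x = g then 1 else 0"
proof -
  fix g :: 'g
  have "(\<lambda>x. (cmod (if x = g then 1 else 0))\<^sup>2) summable_on {g}" by simp
  then show "(\<lambda>x. (cmod (if x = g then 1 else 0))\<^sup>2) summable_on UNIV"
    by (rule summable_on_cong_neutral[THEN iffD1, rotated -1]) auto
qed

lemma inner_ell2_delta: "inner (ell2_delta g) (ell2_delta h) = (if g = h then 1 else 0)"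
proof -
  have "ell2_cinner (ell2_delta g) (ell2_delta h)
      = (\<Sum>\<^sub>\<infinity>x\<in>{g}. cnj (ell2_apply (ell2_delta g) x) * ell2_apply (ell2_delta h) x)"
    unfolding ell2_cinner_def by (rule infsum_cong_neutral) (auto simp: ell2_delta.rep_eq)
  then show ?thesis by (simp add: inner_ell2_def ell2_delta.rep_eq)
qed

lemma translation_ell2_delta: "blinfun_apply (translation g) (ell2_delta 0) = ell2_delta g"
  by (rule ell2_apply_inject[THEN iffD1])
    (auto simp: translation_apply ell2_translate.rep_eq ell2_delta.rep_eq fun_eq_iff
      neg_eq_iff_add_eq_0[symmetric] minus_equation_iff)

lemma ell2_scale_add: "ell2_scale c (\<xi> + \<eta>) = ell2_scale c \<xi> + ell2_scale c \<eta>"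
  by transfer (simp add: distrib_left)

lemma ell2_scale_scale: "ell2_scale c (ell2_scale d \<xi>) = ell2_scale (c * d) \<xi>"
  by transfer (simp add: mult.assoc)

lemma ell2_scale_cartesian: "ell2_scale c \<xi> = Re c *\<^sub>R \<xi> + Im c *\<^sub>R ell2_scale \<i> \<xi>"
  unfolding scaleR_ell2_def ell2_scale_scale
  by (transfer, rule ext) (simp add: complex_eq_iff algebra_simps)

text \<open>Evaluation at \<open>ell2_delta 0\<close> is linear, does not increase distances, and
  sends translations to orthonormal vectors. A complex basis of size \<open>k\<close> gives at most
  \<open>2 * k\<close> real spanning vectors, so \<open>card_orthonormal_approx\<close> yields
  \<open>3 * card S \<le> 8 * k\<close>, which implies the claim.\<close>

lemma card_le_dim_approx:
  fixes S :: "'g::group_add set"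
  assumes S: "finite S" and B: "finite B"
    and approx: "\<And>s. s \<in> S \<Longrightarrow> \<exists>z\<in>op.span B. norm (translation s - z) < 1 / 2"
  shows "card S \<le> 4 * op.dim (op.span B)"
proof -
  obtain C where C: "C \<subseteq> op.span B" "op.independent C" "op.span B \<subseteq> op.span C"
      "card C = op.dim (op.span B)"
    using op.basis_exists[of "op.span B"] by blast
  have fC: "finite C" using op.independent_span_bound[OF B C(2,1)] by simp
  define v where "v z = blinfun_apply z (ell2_delta 0)" for z :: "'g ell2 \<Rightarrow>\<^sub>L 'g ell2"
  let ?V = "v ` C \<union> (\<lambda>z. ell2_scale \<i> (v z)) ` C"
  have card: "card ?V \<le> 2 * card C"
    using card_Un_le[of "v ` C" "(\<lambda>z. ell2_scale \<i> (v z)) ` C"] card_image_le[OF fC, of v]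
      card_image_le[OF fC, of "\<lambda>z. ell2_scale \<i> (v z)"] by linarith
  have span: "v z \<in> span ?V \<and> ell2_scale \<i> (v z) \<in> span ?V" if "z \<in> op.span C" for z
    using that
  proof (induction rule: op.span_induct)
    case base
    have scale: "ell2_scale c (v z) \<in> span ?V"
      if "v z \<in> span ?V" "ell2_scale \<i> (v z) \<in> span ?V" for c z
      unfolding ell2_scale_cartesian[of c] by (intro span_add span_scale that)
    have "v 0 = 0" by (simp add: v_def)
    moreover have "ell2_scale \<i> (0 :: 'g ell2) = 0" by transfer simp
    ultimately show ?case
      using scale
      by (auto simp: op.subspace_def v_def plus_blinfun.rep_eq ell2_scale_add ell2_scale_scale
          op_scale_apply span_add span_zero)
  next
    case (step z)
    then show ?case by (auto intro: span_base)
  qed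
  have "3 * real (card S) \<le> 4 * real (card ?V)"
  proof (rule card_orthonormal_approx[OF S])
    show "inner (ell2_delta s) (ell2_delta t) = (if s = t then 1 else 0)" for s t :: 'g
      by (rule inner_ell2_delta)
    show "finite ?V" using fC by simp
    fix s assume "s \<in> S"
    then obtain z where z: "z \<in> op.span B" "norm (translation s - z) < 1 / 2" using approx by blast
    have "norm (ell2_delta s - v z) = norm (blinfun_apply (translation s - z) (ell2_delta 0))"
      by (simp add: v_def minus_blinfun.rep_eq translation_ell2_delta)
    also have "\<dots> \<le> norm (translation s - z) * norm (ell2_delta (0 :: 'g))" by (rule norm_blinfun)
    also have "norm (ell2_delta (0 :: 'g)) = 1" by (simp add: norm_eq_sqrt_inner inner_ell2_delta)
    finally have "norm (ell2_delta s - v z) < 1 / 2" using z by simp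
    then show "\<exists>w\<in>span ?V. norm (ell2_delta s - w) < 1 / 2" using span z C(3) by blast
  qed
  with card C(4) show ?thesis by linarith
qed

section \<open>The group algebra as the span of the translations\<close>

lemma reduced_cstar_simps [simp]:
  "cs_carrier reduced_cstar = closure group_algebra" "cs_scale reduced_cstar = op_scale"
  "cs_mult reduced_cstar = (o\<^sub>L)" "cs_one reduced_cstar = id_blinfun" "cs_norm reduced_cstar = norm"
  by (simp_all add: reduced_cstar_def)

lemma left_regular_superset:
  assumes "finite S" "{g. f g \<noteq> 0} \<subseteq> S"
  shows "left_regular f = (\<Sum>g\<in>S. op_scale (f g) (translation g))"
  unfolding left_regular_def using assms by (intro sum.mono_neutral_left) auto

lemma group_algebraE:
  assumes "a \<in> group_algebra"
  obtains f where "finite {g. f g \<noteq> 0}" "a = left_regular f"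
  using assms unfolding group_algebra_def fin_supp_def by blast

lemma translation_left_regular: "translation g = left_regular (\<lambda>x. if x = g then 1 else 0)"
  by (subst left_regular_superset[of "{g}"]) auto

text \<open>Makes span induction available, so that linear statements need checking only on
  translations. For closure under addition, both sums are written over the union of the
  supports.\<close>

lemma group_algebra_span:
  "(group_algebra :: ('g::group_add ell2 \<Rightarrow>\<^sub>L 'g ell2) set) = op.span (range translation)"
  (is "?G = _")
proof
  show "?G \<subseteq> op.span (range translation)"
    unfolding group_algebra_def left_regular_def
    by (intro image_subsetI op.span_sum op.span_scale op.span_base) auto
  show "op.span (range translation) \<subseteq> ?G"
  proof (rule op.span_minimal)
    show "range translation \<subseteq> ?G"
      unfolding group_algebra_def translation_left_regular
      by (intro image_subsetI image_eqI[OF refl]) (simp add: fin_supp_def)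
    show "op.subspace ?G"
    proof -
      have scale: "op_scale c a \<in> ?G" if "a \<in> ?G" for c a
      proof -
        obtain f where f: "finite {g. f g \<noteq> 0}" "left_regular f = a"
          using \<open>a \<in> ?G\<close> by (metis group_algebraE)
        have "left_regular (\<lambda>g. c * f g) = (\<Sum>g | f g \<noteq> 0. op_scale (c * f g) (translation g))"
          by (rule left_regular_superset) (use f in auto)
        also have "\<dots> = op_scale c a"
          unfolding f(2)[symmetric] left_regular_def op.scale_sum_right op.scale_scale ..
        finally have "op_scale c a = left_regular (\<lambda>g. c * f g)" ..
        moreover have "finite {g. c * f g \<noteq> 0}" by (rule finite_subset[OF _ f(1)]) auto
        ultimately show ?thesis unfolding group_algebra_def fin_supp_def by (intro image_eqI CollectI)
      qed
      have add: "a + b \<in> ?G" if "a \<in> ?G" "b \<in> ?G" for a b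
      proof -
        obtain f where f: "finite {g. f g \<noteq> 0}" "left_regular f = a"
          using \<open>a \<in> ?G\<close> by (metis group_algebraE)
        obtain h where h: "finite {g. h g \<noteq> 0}" "left_regular h = b"
          using \<open>b \<in> ?G\<close> by (metis group_algebraE)
        let ?S = "{g. f g \<noteq> 0} \<union> {g. h g \<noteq> 0}"
        have S: "finite ?S" "{g. f g + h g \<noteq> 0} \<subseteq> ?S" using f h by auto
        have "a + b = left_regular (\<lambda>g. f g + h g)"
          unfolding f(2)[symmetric] h(2)[symmetric] left_regular_superset[OF S]
            left_regular_superset[OF S(1) Un_upper1] left_regular_superset[OF S(1) Un_upper2]
          by (simp only: op.scale_left_distrib sum.distrib)
        moreover have "finite {g. f g + h g \<noteq> 0}" by (rule finite_subset[OF S(2,1)])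
        ultimately show ?thesis unfolding group_algebra_def fin_supp_def by (intro image_eqI CollectI)
      qed
      have "0 \<in> ?G"
        unfolding group_algebra_def fin_supp_def
        by (rule image_eqI[where x = "\<lambda>_. 0"]) (simp_all add: left_regular_def)
      then show ?thesis using scale add by (simp add: op.subspace_def)
    qed
  qed
qed

lemma span_translation_carrier: "op.span (translation ` K) \<subseteq> closure group_algebra"
  using op.span_mono[of "translation ` K" "range translation"] closure_subset
  unfolding group_algebra_span by blast

lemma group_algebra_finite_span:
  assumes "finite \<Omega>" "\<Omega> \<subseteq> group_algebra"
  obtains K where "finite K" "\<Omega> \<subseteq> op.span (translation ` K)"
proof -
  have "\<forall>a\<in>\<Omega>. \<exists>K. finite K \<and> a \<in> op.span (translation ` K)"
  proof
    fix a assume "a \<in> \<Omega>"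
    then have a: "a \<in> group_algebra" using assms by blast
    obtain f where "finite {g. f g \<noteq> 0}" "a = left_regular f"
      using a by (rule group_algebraE)
    then show "\<exists>K. finite K \<and> a \<in> op.span (translation ` K)"
      unfolding left_regular_def
      by (intro exI[of _ "{g. f g \<noteq> 0}"] conjI) (auto intro!: op.span_sum intro: op.span_scale op.span_base)
  qed
  from bchoice[OF this] obtain K where
    K: "\<And>a. a \<in> \<Omega> \<Longrightarrow> finite (K a)" "\<And>a. a \<in> \<Omega> \<Longrightarrow> a \<in> op.span (translation ` K a)"
    by blast
  show thesis
  proof (rule that[of "\<Union>a\<in>\<Omega>. K a"])
    show "finite (\<Union>a\<in>\<Omega>. K a)" using K assms by auto
    show "\<Omega> \<subseteq> op.span (translation ` (\<Union>a\<in>\<Omega>. K a))"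
      using K(2) op.span_mono[of "translation ` K a" "translation ` (\<Union>a\<in>\<Omega>. K a)" for a] by blast
  qed
qed

lemma translation_compose: "translation g o\<^sub>L translation h = translation (g + h)"
proof (rule blinfun_eqI)
  fix \<xi>
  have "ell2_translate g (ell2_translate h \<xi>) = ell2_translate (g + h) \<xi>"
    by transfer (simp only: minus_add add.assoc)
  then show "blinfun_apply (translation g o\<^sub>L translation h) \<xi> = blinfun_apply (translation (g + h)) \<xi>"
    by (simp add: translation_apply)
qed

lemma translation_0: "translation 0 = id_blinfun"
proof (rule blinfun_eqI)
  fix \<xi> :: "'a ell2"
  have "ell2_translate 0 \<xi> = \<xi>" by transfer simp
  then show "blinfun_apply (translation 0) \<xi> = blinfun_apply id_blinfun \<xi>"
    by (simp add: translation_apply)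
qed

text \<open>Composition is bilinear, so both factors reduce in turn to translations, whose indices
  add up.\<close>

lemma span_translation_mult:
  assumes a: "a \<in> op.span (translation ` A)" and b: "b \<in> op.span (translation ` B)"
  shows "a o\<^sub>L b \<in> op.span (translation ` (\<lambda>(x, y). x + y) ` (A \<times> B))"
proof -
  let ?S = "op.span (translation ` (\<lambda>(x, y). x + y) ` (A \<times> B))"
  have t: "translation x o\<^sub>L b \<in> ?S" if x: "x \<in> A" for x
    using b
  proof (induction rule: op.span_induct)
    case base
    have "translation x o\<^sub>L op_scale c b = op_scale c (translation x o\<^sub>L b)" for c b
    proof (rule blinfun_eqI)
      fix \<xi>
      have "ell2_translate x (ell2_scale c \<eta>) = ell2_scale c (ell2_translate x \<eta>)" for \<eta>
        by transfer simp
      then show "blinfun_apply (translation x o\<^sub>L op_scale c b) \<xi>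
          = blinfun_apply (op_scale c (translation x o\<^sub>L b)) \<xi>"
        by (simp add: translation_apply op_scale_apply)
    qed
    then show ?case
      by (auto simp: op.subspace_def op.span_zero op.span_add op.span_scale
          bounded_bilinear.add_right[OF bounded_bilinear_blinfun_compose]
          bounded_bilinear.zero_right[OF bounded_bilinear_blinfun_compose])
  next
    case (step b)
    with x show ?case by (auto simp: translation_compose intro!: op.span_base)
  qed
  show ?thesis
    using a
  proof (induction rule: op.span_induct)
    case base
    have "op_scale c a o\<^sub>L b = op_scale c (a o\<^sub>L b)" for c a
      by (rule blinfun_eqI) (simp add: op_scale_apply)
    then show ?case
      by (auto simp: op.subspace_def op.span_zero op.span_add op.span_scale
          bounded_bilinear.add_left[OF bounded_bilinear_blinfun_compose]
          bounded_bilinear.zero_left[OF bounded_bilinear_blinfun_compose])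
  next
    case (step a)
    with t show ?case by auto
  qed
qed

lemma norm_translation_le: "norm (translation g) \<le> 1"
  by (rule norm_blinfun_bound) (simp_all add: translation_apply norm_ell2_translate)

text \<open>The span of the translations is itself a candidate in the infimum, with error zero;
  hence the bound does not involve \<open>\<delta>\<close>.\<close>

lemma approx_dim_le:
  assumes S: "finite S" and Y: "Y \<subseteq> op.span (translation ` S)" and \<delta>: "\<delta> > 0"
  shows "approx_dim reduced_cstar Y \<delta> \<le> enat (card S)"
proof -
  let ?Z = "op.span (translation ` S)"
  have "op.dim ?Z \<le> card S"
    using op.dim_le_card[of ?Z "translation ` S"] card_image_le[OF S, of translation] S by simp
  moreover have "\<forall>y\<in>Y. \<exists>z\<in>?Z. norm (y - z) < \<delta>"
  proof
    fix y assume "y \<in> Y"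
    with Y \<delta> show "\<exists>z\<in>?Z. norm (y - z) < \<delta>" by (intro bexI[of _ y]) auto
  qed
  ultimately show ?thesis
    unfolding approx_dim_def using S span_translation_carrier[of S]
    by (intro INF_lower2[of ?Z]) auto
qed

text \<open>The quotient is \<open>card S / 4\<close> rounded up, the integer form of
  \<open>card S \<le> 4 * dim\<close>. It is positive for nonempty \<open>S\<close>, so its
  logarithm is finite.\<close>

lemma approx_dim_ge:
  assumes S: "finite S"
  shows "enat ((card S + 3) div 4) \<le> approx_dim reduced_cstar (translation ` S) (1 / 2)"
  unfolding approx_dim_def
proof (rule INF_greatest)
  fix Z
  assume "Z \<in> {Z. Z \<subseteq> cs_carrier reduced_cstar \<and> (\<exists>B. finite B \<and> Modules.module.span (cs_scale reduced_cstar) B = Z) \<and>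
      (\<forall>y\<in>translation ` S. \<exists>z\<in>Z. cs_norm reduced_cstar (y - z) < 1 / 2)}"
  then obtain B where B: "finite B" "op.span B = Z" "\<And>s. s \<in> S \<Longrightarrow> \<exists>z\<in>Z. norm (translation s - z) < 1 / 2"
    by auto
  then have "card S \<le> 4 * op.dim Z" using card_le_dim_approx[OF S B(1)] by simp
  then show "enat ((card S + 3) div 4) \<le> enat (vector_space.dim (cs_scale reduced_cstar) Z)" by simp
qed


section \<open>The automorphism on the group algebra\<close>

text \<open>\<open>\<beta>\<close> is prescribed on the carrier only, so its properties are read off
  there from \<open>\<Phi>\<close> and \<open>\<alpha>\<close>.\<close>

locale torus_automorphism =
  fixes T :: "int ^ 'd ^ 'd"
    and \<alpha> :: "(complex ^ 'd \<Rightarrow> complex) \<Rightarrow> (complex ^ 'd \<Rightarrow> complex)"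
    and \<Phi> :: "((int ^ 'd) ell2 \<Rightarrow>\<^sub>L (int ^ 'd) ell2) \<Rightarrow> (complex ^ 'd \<Rightarrow> complex)"
    and \<beta> :: "((int ^ 'd) ell2 \<Rightarrow>\<^sub>L (int ^ 'd) ell2) \<Rightarrow> ((int ^ 'd) ell2 \<Rightarrow>\<^sub>L (int ^ 'd) ell2)"
  assumes \<alpha>: "star_automorphism C_torus \<alpha>"
    and \<alpha>_char: "\<And>x. \<alpha> (torus_char x) = torus_char (T *v x)"
    and \<Phi>: "star_isomorphism reduced_cstar C_torus \<Phi>"
    and \<Phi>_translation: "\<And>x. \<Phi> (translation x) = torus_char x"
    and \<beta>: "\<And>a. a \<in> closure group_algebra \<Longrightarrow>
           \<beta> a = the_inv_into (closure group_algebra) \<Phi> (\<alpha> (\<Phi> a))"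
begin

text \<open>\<open>\<Phi>\<close> is injective on the carrier, so a value of \<open>\<beta>\<close>
  can be identified by comparing images on the torus.\<close>

lemma \<beta>_eqI:
  assumes "a \<in> closure group_algebra" "b \<in> closure group_algebra" "\<Phi> b = \<alpha> (\<Phi> a)"
  shows "\<beta> a = b"
proof -
  have "inj_on \<Phi> (closure group_algebra)"
    using \<Phi> by (simp add: star_isomorphism_def bij_betw_def)
  then show ?thesis using assms \<beta> the_inv_into_f_f by metis
qed

lemma \<beta>_carrier:
  assumes "a \<in> closure group_algebra"
  shows "\<Phi> (\<beta> a) = \<alpha> (\<Phi> a)" "\<beta> a \<in> closure group_algebra" "\<Phi> a \<in> cs_carrier C_torus"
proof -
  have bij: "bij_betw \<Phi> (closure group_algebra) (cs_carrier C_torus)"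
    and bij': "bij_betw \<alpha> (cs_carrier C_torus) (cs_carrier C_torus)"
    using \<Phi> \<alpha> by (simp_all add: star_isomorphism_def)
  show a: "\<Phi> a \<in> cs_carrier C_torus" by (rule bij_betwE[OF bij, rule_format, OF assms])
  then have "\<alpha> (\<Phi> a) \<in> cs_carrier C_torus" by (rule bij_betwE[OF bij', rule_format])
  then show "\<Phi> (\<beta> a) = \<alpha> (\<Phi> a)" "\<beta> a \<in> closure group_algebra"
    using bij the_inv_into_into[of \<Phi> "closure group_algebra" "\<alpha> (\<Phi> a)"]
    unfolding \<beta>[OF assms] by (auto simp: f_the_inv_into_f_bij_betw bij_betw_def)
qed

lemma translation_carrier: "translation x \<in> closure group_algebra"
  using span_translation_carrier[of "{x}"] op.span_base[of "translation x"] by blast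

lemma \<beta>_translation: "\<beta> (translation x) = translation (T *v x)"
  by (rule \<beta>_eqI) (simp_all add: translation_carrier \<Phi>_translation \<alpha>_char)

lemma \<beta>_funpow_translation: "(\<beta> ^^ n) (translation x) = translation (((*v) T ^^ n) x)"
  by (induction n) (simp_all add: \<beta>_translation)

text \<open>Linearity of \<open>\<beta>\<close> is inherited from \<open>\<Phi>\<close> and
  \<open>\<alpha>\<close>, but only for arguments and values in the carrier. The induction therefore
  carries the membership \<open>a \<in> ?G\<close> along with the claim.\<close>

lemma \<beta>_span:
  assumes "a \<in> op.span (translation ` K)"
  shows "\<beta> a \<in> op.span (translation ` ((*v) T ` K))"
proof -
  let ?S = "op.span (translation ` ((*v) T ` K))" and ?G = "op.span (range translation)"
  have G: "?G \<subseteq> closure group_algebra" by (rule span_translation_carrier)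
  have "\<Phi> (a + b) = \<Phi> a + \<Phi> b" if "a \<in> closure group_algebra" "b \<in> closure group_algebra" for a b
    using \<Phi> that by (simp add: star_isomorphism_def)
  moreover have "\<alpha> (f + g) = \<alpha> f + \<alpha> g" if "f \<in> cs_carrier C_torus" "g \<in> cs_carrier C_torus" for f g
    using \<alpha> that by (simp add: star_isomorphism_def)
  ultimately have add: "\<beta> (a + b) = \<beta> a + \<beta> b" if "a \<in> ?G" "b \<in> ?G" "\<beta> a + \<beta> b \<in> ?G" for a b
    using that G \<beta>_carrier[of a] \<beta>_carrier[of b] op.span_add[of a "range translation" b]
    by (intro \<beta>_eqI) (auto simp: subset_iff)
  have "\<Phi> (op_scale c a) = cs_scale C_torus c (\<Phi> a)" if "a \<in> closure group_algebra" for c a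
    using \<Phi> that by (simp add: star_isomorphism_def)
  moreover have "\<alpha> (cs_scale C_torus c f) = cs_scale C_torus c (\<alpha> f)" if "f \<in> cs_carrier C_torus" for c f
    using \<alpha> that by (simp add: star_isomorphism_def)
  ultimately have scale: "\<beta> (op_scale c a) = op_scale c (\<beta> a)" if "a \<in> ?G" "op_scale c (\<beta> a) \<in> ?G" for c a
    using that G \<beta>_carrier[of a] op.span_scale[of a "range translation" c]
    by (intro \<beta>_eqI) (auto simp: subset_iff)
  have SG: "?S \<subseteq> ?G" by (rule op.span_mono) auto
  have "a \<in> ?G \<and> \<beta> a \<in> ?S"
    using assms
  proof (induction rule: op.span_induct)
    case base
    have "\<beta> 0 = 0"
      using scale[of "translation 0" 0] by (simp add: op.span_zero op.span_base)
    then show ?case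
      using add scale SG
      by (auto simp: op.subspace_def op.span_zero op.span_add op.span_scale subset_iff)
  next
    case (step a)
    then show ?case by (auto simp: \<beta>_translation intro: op.span_base)
  qed
  then show ?thesis by simp
qed

lemma \<beta>_funpow_span:
  "a \<in> op.span (translation ` K) \<Longrightarrow> (\<beta> ^^ n) a \<in> op.span (translation ` (((*v) T ^^ n) ` K))"
proof (induction n)
  case (Suc n)
  from \<beta>_span[OF Suc.IH[OF Suc.prems]] show ?case by (simp add: image_image)
qed simp

text \<open>The last factor is supported in \<open>T^n K\<close>, and multiplication adds supports.
  This serves the upper bound.\<close>

lemma orbit_prod_span:
  assumes "\<Omega> \<subseteq> op.span (translation ` K)"
  shows "orbit_prod reduced_cstar \<beta> \<Omega> n \<subseteq> op.span (translation ` orbit_sums T K n)"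
proof (induction n)
  case 0
  show ?case by (auto simp: translation_0[symmetric] intro: op.span_base)
next
  case (Suc n)
  show ?case
  proof
    fix a assume "a \<in> orbit_prod reduced_cstar \<beta> \<Omega> (Suc n)"
    then obtain p w where a: "a = p o\<^sub>L (\<beta> ^^ n) w" "p \<in> orbit_prod reduced_cstar \<beta> \<Omega> n" "w \<in> \<Omega>"
      by auto
    have "a \<in> op.span (translation ` (\<lambda>(x, y). x + y) ` (orbit_sums T K n \<times> ((*v) T ^^ n) ` K))"
      unfolding a(1) using a Suc.IH assms by (intro span_translation_mult \<beta>_funpow_span) auto
    also have "(\<lambda>(x, y). x + y) ` (orbit_sums T K n \<times> ((*v) T ^^ n) ` K) = orbit_sums T K (Suc n)"
      by force
    finally show "a \<in> op.span (translation ` orbit_sums T K (Suc n))" .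
  qed
qed

text \<open>A product of translations is a single translation, so here the product set is known
  exactly, as the lower bound requires.\<close>

lemma orbit_prod_translation:
  "orbit_prod reduced_cstar \<beta> (translation ` K) n = translation ` orbit_sums T K n"
proof (induction n)
  case 0
  show ?case by (simp add: translation_0)
next
  case (Suc n)
  have "orbit_prod reduced_cstar \<beta> (translation ` K) (Suc n)
      = (\<lambda>(x, k). translation x o\<^sub>L (\<beta> ^^ n) (translation k)) ` (orbit_sums T K n \<times> K)"
    by (force simp: Suc)
  also have "\<dots> = translation ` orbit_sums T K (Suc n)"
    by (simp add: orbit_sums_Suc_image image_image split_def \<beta>_funpow_translation translation_compose
        del: orbit_sums.simps)
  finally show ?case .
qed

end


section \<open>Finiteness of the commutator seminorms\<close>

lemma norm_ell2_le:
  assumes "B \<ge> 0" "\<And>x. cmod (ell2_apply \<eta> x) \<le> B * cmod (ell2_apply \<xi> x)"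
  shows "norm \<eta> \<le> B * norm \<xi>"
proof -
  have "(\<Sum>\<^sub>\<infinity>x. (cmod (ell2_apply \<eta> x))\<^sup>2) \<le> (\<Sum>\<^sub>\<infinity>x. B\<^sup>2 * (cmod (ell2_apply \<xi> x))\<^sup>2)"
  proof (rule infsum_mono)
    show "(cmod (ell2_apply \<eta> x))\<^sup>2 \<le> B\<^sup>2 * (cmod (ell2_apply \<xi> x))\<^sup>2" for x
      using power_mono[OF assms(2) norm_ge_zero, of x 2] by (simp add: power_mult_distrib)
  qed (intro square_summable summable_on_cmult_right)+
  also have "\<dots> = B\<^sup>2 * (\<Sum>\<^sub>\<infinity>x. (cmod (ell2_apply \<xi> x))\<^sup>2)" by (rule infsum_cmult_right')
  finally have "sqrt (\<Sum>\<^sub>\<infinity>x. (cmod (ell2_apply \<eta> x))\<^sup>2) \<le> sqrt (B\<^sup>2 * (\<Sum>\<^sub>\<infinity>x. (cmod (ell2_apply \<xi> x))\<^sup>2))"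
    by (rule real_sqrt_le_mono)
  with \<open>B \<ge> 0\<close> show ?thesis by (simp add: norm_ell2_eq real_sqrt_mult)
qed

lemma ell2_apply_Abs_ell2:
  assumes "finite {x. f x \<noteq> 0}" shows "ell2_apply (Abs_ell2 f) = f"
proof -
  have "(\<lambda>x. (cmod (f x))\<^sup>2) summable_on {x. f x \<noteq> 0}" using assms by simp
  then have "(\<lambda>x. (cmod (f x))\<^sup>2) summable_on UNIV"
    by (rule summable_on_cong_neutral[THEN iffD1, rotated -1]) auto
  then show ?thesis by (intro Abs_ell2_inverse) simp
qed

lemma ell2_apply_length_mult:
  assumes "\<xi> \<in> ell2_fin_supp"
  shows "ell2_apply (length_mult len \<xi>) x = of_nat (len x) * ell2_apply \<xi> x"
proof -
  have "finite {x. of_nat (len x) * ell2_apply \<xi> x \<noteq> 0}"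
    by (rule finite_subset[of _ "{x. ell2_apply \<xi> x \<noteq> 0}"])
      (use assms in \<open>auto simp: ell2_fin_supp_def fin_supp_def\<close>)
  then show ?thesis by (simp add: length_mult_def ell2_apply_Abs_ell2)
qed

lemma length_mult_fin_supp:
  assumes "\<xi> \<in> ell2_fin_supp" shows "length_mult len \<xi> \<in> ell2_fin_supp"
proof -
  have "finite {x. ell2_apply (length_mult len \<xi>) x \<noteq> 0}"
    by (rule finite_subset[of _ "{x. ell2_apply \<xi> x \<noteq> 0}"])
      (use assms in \<open>auto simp: ell2_fin_supp_def fin_supp_def ell2_apply_length_mult\<close>)
  then show ?thesis by (simp add: ell2_fin_supp_def fin_supp_def)
qed

lemma ell2_apply_sum: "ell2_apply (\<Sum>s\<in>S. F s) x = (\<Sum>s\<in>S. ell2_apply (F s) x)"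
  by (induction S rule: infinite_finite_induct) (simp_all add: zero_ell2.rep_eq plus_ell2.rep_eq)

lemma ell2_apply_diff: "ell2_apply (\<xi> - \<eta>) x = ell2_apply \<xi> x - ell2_apply \<eta> x"
  unfolding minus_ell2_def plus_ell2.rep_eq uminus_ell2.rep_eq by simp

lemma ell2_apply_left_regular:
  "ell2_apply (blinfun_apply (left_regular f) \<xi>) x = (\<Sum>g | f g \<noteq> 0. f g * ell2_apply \<xi> (- g + x))"
  by (simp add: left_regular_def blinfun.sum_left ell2_apply_sum op_scale_apply translation_apply
      ell2_scale.rep_eq ell2_translate.rep_eq)

text \<open>Each commutator multiplies the coefficient leading from \<open>- g + x\<close> to
  \<open>x\<close> by the difference of their lengths. Finite support is proved simultaneously,
  because \<open>length_mult\<close> is meaningful only there, and \<open>\<xi>\<close> is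
  generalised because the next commutator also acts on \<open>length_mult len \<xi>\<close>.\<close>

lemma iter_commutator_left_regular:
  assumes f: "finite {g. f g \<noteq> 0}" and \<xi>: "\<xi> \<in> ell2_fin_supp"
  shows "iter_commutator len k (left_regular f) \<xi> \<in> ell2_fin_supp \<and>
    (\<forall>x. ell2_apply (iter_commutator len k (left_regular f) \<xi>) x
      = (\<Sum>g | f g \<noteq> 0. f g * (of_nat (len x) - of_nat (len (- g + x))) ^ k * ell2_apply \<xi> (- g + x)))"
  using \<xi>
proof (induction k arbitrary: \<xi>)
  \<comment> \<open>Whatever the coefficients \<open>c\<close>, the support lies in the support of
    \<open>f\<close> plus that of \<open>\<xi>\<close>.\<close>
  have supp: "\<eta> \<in> ell2_fin_supp"
    if \<xi>: "\<xi> \<in> ell2_fin_supp"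
      and \<eta>: "\<And>x. ell2_apply \<eta> x = (\<Sum>g | f g \<noteq> 0. f g * c g x * ell2_apply \<xi> (- g + x))"
    for \<xi> \<eta> c
  proof -
    have "{x. ell2_apply \<eta> x \<noteq> 0} \<subseteq> (\<lambda>(g, y). g + y) ` ({g. f g \<noteq> 0} \<times> {y. ell2_apply \<xi> y \<noteq> 0})"
    proof
      fix x assume "x \<in> {x. ell2_apply \<eta> x \<noteq> 0}"
      then have "(\<Sum>g | f g \<noteq> 0. f g * c g x * ell2_apply \<xi> (- g + x)) \<noteq> 0" by (simp add: \<eta>)
      then obtain g where "g \<in> {g. f g \<noteq> 0}" "f g * c g x * ell2_apply \<xi> (- g + x) \<noteq> 0"
        by (rule sum.not_neutral_contains_not_neutral)
      then show "x \<in> (\<lambda>(g, y). g + y) ` ({g. f g \<noteq> 0} \<times> {y. ell2_apply \<xi> y \<noteq> 0})"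
        by (intro image_eqI[of _ _ "(g, - g + x)"]) simp_all
    qed
    then have "finite {x. ell2_apply \<eta> x \<noteq> 0}"
      by (rule finite_subset) (use f \<xi> in \<open>auto simp: ell2_fin_supp_def fin_supp_def\<close>)
    then show ?thesis by (simp add: ell2_fin_supp_def fin_supp_def)
  qed
  {
    case 0
    then show ?case
      using supp[of \<xi> "iter_commutator len 0 (left_regular f) \<xi>" "\<lambda>_ _. 1"]
      by (simp add: ell2_apply_left_regular)
  next
    case (Suc k)
    let ?d = "\<lambda>g x. of_nat (len x) - of_nat (len (- g + x)) :: complex"
    note IH = Suc.IH[OF Suc.prems] Suc.IH[OF length_mult_fin_supp[OF Suc.prems, of len]]
    have e: "ell2_apply (iter_commutator len (Suc k) (left_regular f) \<xi>) x
        = (\<Sum>g | f g \<noteq> 0. f g * ?d g x ^ Suc k * ell2_apply \<xi> (- g + x))" for x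
    proof -
      have "ell2_apply (iter_commutator len (Suc k) (left_regular f) \<xi>) x
          = of_nat (len x) * (\<Sum>g | f g \<noteq> 0. f g * ?d g x ^ k * ell2_apply \<xi> (- g + x))
            - (\<Sum>g | f g \<noteq> 0. f g * ?d g x ^ k * (of_nat (len (- g + x)) * ell2_apply \<xi> (- g + x)))"
        using IH by (simp add: ell2_apply_diff ell2_apply_length_mult Suc.prems)
      also have "\<dots> = (\<Sum>g | f g \<noteq> 0. f g * ?d g x ^ Suc k * ell2_apply \<xi> (- g + x))"
        unfolding sum_distrib_left sum_subtractf[symmetric]
        by (intro sum.cong) (simp_all add: algebra_simps)
      finally show ?thesis .
    qed
    with supp[OF Suc.prems e] show ?case by blast
  }
qed

text \<open>The iterated commutator is a finite sum of weighted translations, and the weight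
  belonging to \<open>g\<close> is bounded by \<open>cmod (f g) * C g ^ k\<close>.\<close>

lemma length_seminorm_finite:
  assumes a: "a \<in> group_algebra"
    and len: "\<And>g. \<exists>C. \<forall>x. \<bar>real (len x) - real (len (- g + x))\<bar> \<le> C"
  shows "length_seminorm len k a < \<infinity>"
proof -
  obtain f where f: "finite {g. f g \<noteq> 0}" "a = left_regular f" using a by (rule group_algebraE)
  obtain C where C: "\<And>g x. \<bar>real (len x) - real (len (- g + x))\<bar> \<le> C g" using len by metis
  define B where "B = (\<Sum>g | f g \<noteq> 0. cmod (f g) * C g ^ k)"
  have "norm (iter_commutator len k a \<xi>) \<le> B" if \<xi>: "\<xi> \<in> ell2_fin_supp" "norm \<xi> \<le> 1" for \<xi>
  proof -
    let ?z = "\<lambda>g x. f g * (of_nat (len x) - of_nat (len (- g + x))) ^ k * ell2_apply \<xi> (- g + x)"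
    \<comment> \<open>The summand of the commutator belonging to \<open>g\<close>, made into a
      vector of its own so that it can be compared pointwise with the translate of
      \<open>\<xi>\<close> by \<open>g\<close>.\<close>
    define \<zeta> where "\<zeta> g = Abs_ell2 (?z g)" for g
    have "finite {x. ?z g x \<noteq> 0}" for g
    proof (rule finite_subset)
      show "{x. ?z g x \<noteq> 0} \<subseteq> (\<lambda>y. g + y) ` {y. ell2_apply \<xi> y \<noteq> 0}"
      proof
        fix x assume "x \<in> {x. ?z g x \<noteq> 0}"
        then have "ell2_apply \<xi> (- g + x) \<noteq> 0" by auto
        moreover have "x = g + (- g + x)" by (simp add: add.assoc[symmetric])
        ultimately show "x \<in> (\<lambda>y. g + y) ` {y. ell2_apply \<xi> y \<noteq> 0}"
          by (intro image_eqI[of x _ "- g + x"] CollectI)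
      qed
      show "finite ((\<lambda>y. g + y) ` {y. ell2_apply \<xi> y \<noteq> 0})"
        using \<xi> by (simp add: ell2_fin_supp_def fin_supp_def)
    qed
    then have \<zeta>: "ell2_apply (\<zeta> g) = ?z g" for g
      unfolding \<zeta>_def by (rule ell2_apply_Abs_ell2)
    have "iter_commutator len k a \<xi> = (\<Sum>g | f g \<noteq> 0. \<zeta> g)"
      using iter_commutator_left_regular[OF f(1) \<xi>(1), of len k]
      by (intro ell2_apply_inject[THEN iffD1] ext) (simp add: f(2) ell2_apply_sum \<zeta>)
    then have "norm (iter_commutator len k a \<xi>) \<le> (\<Sum>g | f g \<noteq> 0. norm (\<zeta> g))"
      by (simp add: norm_sum)
    also have "\<dots> \<le> B"
      unfolding B_def
    proof (rule sum_mono)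
      fix g
      have C0: "C g \<ge> 0" using C[of 0 g] by linarith
      have "norm (\<zeta> g) \<le> (cmod (f g) * C g ^ k) * norm (ell2_translate g \<xi>)"
      proof (rule norm_ell2_le)
        fix x
        have "cmod (of_nat (len x) - of_nat (len (- g + x))) = \<bar>real (len x) - real (len (- g + x))\<bar>"
        proof -
          have "of_nat (len x) - of_nat (len (- g + x)) = complex_of_real (real (len x) - real (len (- g + x)))"
            by simp
          then show ?thesis by (simp only: norm_of_real)
        qed
        then have "cmod (of_nat (len x) - of_nat (len (- g + x))) ^ k \<le> C g ^ k"
          using C[of x g] by (intro power_mono) auto
        then show "cmod (ell2_apply (\<zeta> g) x) \<le> cmod (f g) * C g ^ k * cmod (ell2_apply (ell2_translate g \<xi>) x)"
          unfolding \<zeta> ell2_translate.rep_eq norm_mult norm_power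
          by (intro mult_right_mono mult_left_mono) auto
      qed (use C0 in simp)
      also have "\<dots> \<le> (cmod (f g) * C g ^ k) * 1"
        using \<xi>(2) C0 by (intro mult_left_mono) (auto simp: norm_ell2_translate)
      finally show "norm (\<zeta> g) \<le> cmod (f g) * C g ^ k" by simp
    qed
    finally show ?thesis .
  qed
  then have "length_seminorm len k a \<le> ereal B"
    unfolding length_seminorm_def using a by (auto intro!: SUP_least)
  then show ?thesis by (rule le_less_trans) simp
qed

section \<open>Word length and its change under translation\<close>

lemma word_length_add_le:
  fixes x y :: "'g::group_add"
  assumes gen: "\<And>x. \<exists>w. set w \<subseteq> S \<union> uminus ` S \<and> sum_list w = x"
  shows "word_length S (x + y) \<le> word_length S x + word_length S y"
proof -
  have ex: "\<exists>w. length w = word_length S x \<and> set w \<subseteq> S \<union> uminus ` S \<and> sum_list w = x" for x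
    unfolding word_length_def by (rule LeastI_ex) (use gen[of x] in blast)
  obtain v where v: "length v = word_length S x" "set v \<subseteq> S \<union> uminus ` S" "sum_list v = x"
    using ex by blast
  obtain w where w: "length w = word_length S y" "set w \<subseteq> S \<union> uminus ` S" "sum_list w = y"
    using ex by blast
  show ?thesis
    unfolding word_length_def[of S "x + y"]
    by (rule Least_le) (use v w in \<open>auto intro!: exI[of _ "v @ w"]\<close>)
qed

text \<open>\<open>x\<close> is the sum of its axis components, and each of these is reached from 0
  by adding or subtracting \<open>axis i 1\<close>. This guarantees that the minimum in
  \<open>word_length\<close> is attained.\<close>

lemma axis_generate:
  fixes x :: "int ^ 'd"
  shows "\<exists>w. set w \<subseteq> range (\<lambda>i. axis i 1) \<union> uminus ` range (\<lambda>i. axis i 1) \<and> sum_list w = x"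
proof -
  define G :: "(int ^ 'd) set" where "G = range (\<lambda>i. axis i 1) \<union> uminus ` range (\<lambda>i. axis i 1)"
  define P where "P x \<longleftrightarrow> (\<exists>w. set w \<subseteq> G \<and> sum_list w = x)" for x
  have zero: "P 0" unfolding P_def by (intro exI[of _ "[]"]) simp
  have add: "P (x + y)" if "P x" "P y" for x y
  proof -
    from that obtain v w where "set v \<subseteq> G" "sum_list v = x" "set w \<subseteq> G" "sum_list w = y"
      unfolding P_def by blast
    then show ?thesis unfolding P_def by (intro exI[of _ "v @ w"]) simp
  qed
  have gen: "P (axis i 1)" "P (- axis i 1)" for i
    unfolding P_def by (rule exI[of _ "[axis i 1]"], simp add: G_def) (rule exI[of _ "[- axis i 1]"], simp add: G_def)
  have axis: "P (axis i n)" for i :: 'd and n :: int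
  proof (induction n rule: int_induct[where k = 0])
    case base
    have "axis i 0 = (0 :: int ^ 'd)" by (simp add: vec_eq_iff axis_def)
    then show ?case using zero by (simp only:)
  next
    case (step1 n)
    have "axis i (n + 1) = axis i n + axis i 1" by (simp add: vec_eq_iff axis_def)
    then show ?case using add step1(2) gen(1) by simp
  next
    case (step2 n)
    have "axis i (n - 1) = axis i n + - axis i 1" by (simp add: vec_eq_iff axis_def)
    then show ?case using add[OF step2(2) gen(2)] by simp
  qed
  have sum: "P (\<Sum>i\<in>I. axis i (x $ i))" if "finite I" for I
    using that by (induction I rule: finite_induct) (simp_all add: zero add axis)
  have eq: "(\<Sum>i\<in>UNIV. axis i (x $ i)) = x" by (simp add: vec_eq_iff axis_def)
  have "P x" using sum[OF finite[of UNIV]] unfolding eq .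
  then show ?thesis unfolding P_def G_def .
qed

text \<open>Subadditivity applied to \<open>x = g + (- g + x)\<close> and to \<open>- g + x\<close>;
  the constant is the length of \<open>g\<close> plus that of \<open>- g\<close>.\<close>

lemma std_length_diff_bounded:
  "\<exists>C. \<forall>x. \<bar>real (std_length x) - real (std_length (- g + x))\<bar> \<le> C"
proof -
  have sub: "std_length (x + y) \<le> std_length x + std_length y" for x y :: "int ^ 'a"
    unfolding std_length_def by (rule word_length_add_le[OF axis_generate])
  have "\<bar>real (std_length x) - real (std_length (- g + x))\<bar>
      \<le> real (std_length g) + real (std_length (- g))" for x
    using sub[of g "- g + x"] sub[of "- g" x] by (simp add: abs_le_iff)
  then show ?thesis by blast
qed


section \<open>Entropy\<close>

lemma log_enat_mono: "m \<le> n \<Longrightarrow> log_enat m \<le> log_enat n"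
  by (cases m; cases n) (auto simp: log_enat_def)

text \<open>A constant factor \<open>exp a\<close> in a cardinality estimate vanishes in the
  exponential growth rate.\<close>

lemma tendsto_log_rate:
  "(\<lambda>n. ereal (1 / real n * (a + real n * b))) \<longlonglongrightarrow> ereal b"
proof -
  have "(\<lambda>n. a / real n + b) \<longlonglongrightarrow> 0 + b"
    by (intro tendsto_add lim_const_over_n tendsto_const)
  moreover have "eventually (\<lambda>n. a / real n + b = 1 / real n * (a + real n * b)) sequentially"
    using eventually_gt_at_top[of 0] by eventually_elim (simp add: field_simps)
  ultimately have "(\<lambda>n. 1 / real n * (a + real n * b)) \<longlonglongrightarrow> b"
    using Lim_transform_eventually by fastforce
  then show ?thesis by simp
qed

context torus_automorphism
begin

text \<open>\<open>D\<close> is at most the cardinality of the orbit sum, hence at most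
  \<open>C * R ^ n\<close> with every eigenvalue modulus enlarged by \<open>\<epsilon>\<close>; the
  enlargement costs at most \<open>e\<close> in the rate.\<close>

lemma product_entropy_le:
  fixes r :: "'d \<Rightarrow> nat"
  assumes "inj r" "det Q \<noteq> 0" "Q ** complex_matrix T = U ** Q"
    and "\<And>i j. r j < r i \<Longrightarrow> U $ i $ j = 0"
    and "\<And>i j. r i \<le> r j \<Longrightarrow> cmod (U $ j $ j) \<le> cmod (U $ i $ i)"
    and \<Omega>: "finite \<Omega>" "\<Omega> \<subseteq> group_algebra" and \<delta>: "\<delta> > 0"
  shows "limsup (\<lambda>n. ereal (1 / real n) * log_enat (approx_dim reduced_cstar (orbit_prod reduced_cstar \<beta> \<Omega> n) \<delta>))
    \<le> ereal (\<Sum>i\<in>UNIV. ln (max 1 (cmod (U $ i $ i))))"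
    (is "limsup ?f \<le> ereal ?h")
proof (rule ereal_le_epsilon2)
  fix e :: real assume "e > 0"
  \<comment> \<open>The error is divided equally among the coordinates.\<close>
  define \<epsilon> where "\<epsilon> = e / real CARD('d)"
  have \<epsilon>: "\<epsilon> > 0" using \<open>e > 0\<close> by (simp add: \<epsilon>_def)
  obtain K where K: "finite K" "\<Omega> \<subseteq> op.span (translation ` K)"
    using group_algebra_finite_span[OF \<Omega>] by blast
  \<comment> \<open>Inserting 0 keeps the orbit sums nonempty even if \<open>K\<close> is empty, so
    the logarithm is taken of a positive number.\<close>
  let ?S = "orbit_sums T (insert 0 K)"
  define R where "R = (\<Prod>i\<in>UNIV. max 1 (cmod (U $ i $ i)) + \<epsilon>)"
  have R: "R > 0" unfolding R_def using \<epsilon> by (intro prod_pos) (auto intro: add_pos_pos)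
  obtain C where C: "C > 0" "\<And>n. real (card (?S n)) \<le> C * R ^ n"
    unfolding R_def
    by (rule card_orbit_sums_le[OF assms(1-5), where K = "insert 0 K" and \<epsilon> = \<epsilon>])
      (use K(1) \<epsilon> in auto)
  have fin: "finite (?S n)" for n using K(1) by (intro finite_orbit_sums) simp
  have "\<Omega> \<subseteq> op.span (translation ` insert 0 K)"
    using K(2) op.span_mono[of "translation ` K" "translation ` insert 0 K"] by blast
  from approx_dim_le[OF fin orbit_prod_span[OF this] \<delta>]
  have "log_enat (approx_dim reduced_cstar (orbit_prod reduced_cstar \<beta> \<Omega> n) \<delta>) \<le> log_enat (enat (card (?S n)))" for n
    by (rule log_enat_mono)
  moreover have "log_enat (enat (card (?S n))) \<le> ereal (ln C + real n * ln R)" for n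
  proof -
    have "card (?S n) > 0" using fin[of n] orbit_sums_nonempty[of "insert 0 K" T n] by (simp add: card_gt_0_iff)
    moreover from this have "ln (real (card (?S n))) \<le> ln (C * R ^ n)" using C(2)[of n] by (intro ln_mono) auto
    moreover have "ln (C * R ^ n) = ln C + real n * ln R" using C(1) R by (simp add: ln_mult ln_realpow)
    ultimately show ?thesis by (simp add: log_enat_def)
  qed
  ultimately have "log_enat (approx_dim reduced_cstar (orbit_prod reduced_cstar \<beta> \<Omega> n) \<delta>)
      \<le> ereal (ln C + real n * ln R)" for n
    by (rule order_trans)
  then have "?f n \<le> ereal (1 / real n * (ln C + real n * ln R))" for n
    using ereal_mult_left_mono[of _ "ereal (ln C + real n * ln R)" "ereal (1 / real n)"] by simp
  then have "limsup ?f \<le> limsup (\<lambda>n. ereal (1 / real n * (ln C + real n * ln R)))"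
    by (intro Limsup_mono always_eventually) auto
  also have "\<dots> = ereal (ln R)"
    by (rule lim_imp_Limsup[OF _ tendsto_log_rate]) simp
  also have "ln R \<le> ?h + e"
  proof -
    have "ln R = (\<Sum>i\<in>UNIV. ln (max 1 (cmod (U $ i $ i)) + \<epsilon>))"
      unfolding R_def using \<epsilon> by (intro ln_prod) (auto intro: add_pos_pos)
    also have "\<dots> \<le> (\<Sum>i\<in>UNIV. ln (max 1 (cmod (U $ i $ i))) + \<epsilon>)"
    proof (rule sum_mono)
      fix i
      define a where "a = max 1 (cmod (U $ i $ i))"
      have a: "a \<ge> 1" by (simp add: a_def)
      have "ln (a + \<epsilon>) \<le> ln (a * exp \<epsilon>)"
      proof (rule ln_mono)
        \<comment> \<open>As \<open>a \<ge> 1\<close>, the additive enlargement is dominated by the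
          factor \<open>exp \<epsilon>\<close>.\<close>
        have "a + \<epsilon> \<le> a * (1 + \<epsilon>)" using a \<epsilon> by (simp add: algebra_simps)
        also have "\<dots> \<le> a * exp \<epsilon>" using a by (intro mult_left_mono) auto
        finally show "a + \<epsilon> \<le> a * exp \<epsilon>" .
      qed (use a \<epsilon> in auto)
      also have "\<dots> = ln a + \<epsilon>" using a by (simp add: ln_mult)
      finally show "ln (max 1 (cmod (U $ i $ i)) + \<epsilon>) \<le> ln (max 1 (cmod (U $ i $ i))) + \<epsilon>"
        by (simp add: a_def)
    qed
    also have "\<dots> = ?h + e" by (simp add: sum.distrib \<epsilon>_def)
    finally show ?thesis .
  qed
  finally show "limsup ?f \<le> ereal ?h + ereal e" by simp
qed

text \<open>\<open>K\<close> is the integer box from \<open>card_orbit_sums_ge\<close>. The orbit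
  products of its translations are the translations by the orbit sum, for which
  \<open>approx_dim_ge\<close> bounds \<open>D\<close> from below.\<close>

lemma product_entropy_ge:
  fixes r :: "'d \<Rightarrow> nat"
  assumes "inj r" "det Q \<noteq> 0" "Q ** complex_matrix T = U ** Q"
    and "\<And>i j. r j < r i \<Longrightarrow> U $ i $ j = 0"
  obtains K where "finite K"
    "ereal (\<Sum>i\<in>UNIV. ln (max 1 (cmod (U $ i $ i)))) \<le> limsup (\<lambda>n. ereal (1 / real n) *
      log_enat (approx_dim reduced_cstar (orbit_prod reduced_cstar \<beta> (translation ` K) n) (1 / 2)))"
proof -
  define R where "R = (\<Prod>i\<in>UNIV. max 1 (cmod (U $ i $ i)))"
  have R: "R > 0" unfolding R_def by (intro prod_pos) (auto simp: less_max_iff_disj)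
  obtain c m where c: "c > 0" "\<And>n. c * R ^ n \<le> real (card (orbit_sums T (int_box m) (Suc n)))"
    using card_orbit_sums_ge[OF assms, folded R_def] by blast
  let ?K = "int_box m :: (int ^ 'd) set"
  let ?f = "\<lambda>n. ereal (1 / real n) *
      log_enat (approx_dim reduced_cstar (orbit_prod reduced_cstar \<beta> (translation ` ?K) n) (1 / 2))"
  \<comment> \<open>Collects the constant \<open>c\<close>, the loss of a factor 4 in
    \<open>approx_dim_ge\<close>, and the shift from \<open>R ^ n\<close> to
    \<open>R ^ (n - 1)\<close>.\<close>
  define a where "a = ln (c / 4) - ln R"
  have bound: "ereal (1 / real n * (a + real n * ln R)) \<le> ?f n" if n: "n > 0" for n
  proof -
    let ?S = "orbit_sums T ?K n"
    obtain l where l: "n = Suc l" using n by (cases n) auto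
    define q where "q = (card ?S + 3) div 4"
    have "real (card ?S) \<le> 4 * real q"
    proof -
      have "card ?S \<le> 4 * q" unfolding q_def by linarith
      then show ?thesis by linarith
    qed
    with c(2)[of l] have q: "c / 4 * R ^ l \<le> real q" by (simp add: l)
    have pos: "c / 4 * R ^ l > 0" using c(1) R by simp
    have "a + real n * ln R = ln (c / 4 * R ^ l)"
      using c(1) R by (subst ln_mult) (simp_all add: a_def l ln_realpow algebra_simps)
    also have "\<dots> \<le> ln (real q)" using q pos by (intro ln_mono) auto
    finally have "ereal (a + real n * ln R) \<le> log_enat (enat q)"
      using q pos by (simp add: log_enat_def)
    also have "\<dots> \<le> log_enat (approx_dim reduced_cstar (orbit_prod reduced_cstar \<beta> (translation ` ?K) n) (1 / 2))"
      unfolding orbit_prod_translation q_def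
      by (intro log_enat_mono approx_dim_ge finite_orbit_sums finite_int_box)
    finally show ?thesis
      using ereal_mult_left_mono[of "ereal (a + real n * ln R)" _ "ereal (1 / real n)"] by simp
  qed
  have "ereal (ln R) = limsup (\<lambda>n. ereal (1 / real n * (a + real n * ln R)))"
    by (rule lim_imp_Limsup[OF _ tendsto_log_rate, symmetric]) simp
  also have "\<dots> \<le> limsup ?f"
    by (intro Limsup_mono eventually_mono[OF eventually_gt_at_top[of 0]] bound)
  finally have "ereal (ln R) \<le> limsup ?f" .
  moreover have "ln R = (\<Sum>i\<in>UNIV. ln (max 1 (cmod (U $ i $ i))))"
    unfolding R_def by (intro ln_prod) (auto simp: less_max_iff_disj)
  ultimately show thesis by (intro that[of ?K]) (simp_all add: finite_int_box)
qed

text \<open>The lower bound needs one member of each supremum: a finite set of translations, which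
  have norm at most 1, and the precision 1/2.\<close>

lemma Entp_eq:
  "Entp \<beta> = ereal (\<Sum>\<mu> | \<mu> \<in> eigenvalues (complex_matrix T) \<and> cmod \<mu> > 1.
    real (spectral_multiplicity \<mu> (complex_matrix T)) * ln (cmod \<mu>))"
proof -
  obtain r :: "'d \<Rightarrow> nat" and Q U :: "complex ^ 'd ^ 'd" where
    rQ: "inj r" "det Q \<noteq> 0" "Q ** complex_matrix T = U ** Q"
    and U: "\<And>i j. r j < r i \<Longrightarrow> U $ i $ j = 0"
    and sorted: "\<And>i j. r i \<le> r j \<Longrightarrow> cmod (U $ j $ j) \<le> cmod (U $ i $ i)"
    using triangular_form[of "complex_matrix T"] by blast
  let ?h = "\<Sum>i\<in>UNIV. ln (max 1 (cmod (U $ i $ i)))"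
  let ?B = "{a \<in> group_algebra. norm a \<le> 1} :: ((int ^ 'd) ell2 \<Rightarrow>\<^sub>L (int ^ 'd) ell2) set"
  have "Entp \<beta> \<le> ereal ?h"
    unfolding Entp_def product_entropy_over_def
    by (intro SUP_least product_entropy_le[OF rQ U sorted]) auto
  moreover have "ereal ?h \<le> Entp \<beta>"
  proof -
    obtain K where K: "finite K" "ereal ?h \<le> limsup (\<lambda>n. ereal (1 / real n) *
        log_enat (approx_dim reduced_cstar (orbit_prod reduced_cstar \<beta> (translation ` K) n) (1 / 2)))"
      using product_entropy_ge[OF rQ U] by blast
    have "translation ` K \<subseteq> ?B"
      using norm_translation_le by (auto simp: group_algebra_span intro: op.span_base)
    with K(1) have "translation ` K \<in> {\<Omega>. finite \<Omega> \<and> \<Omega> \<subseteq> ?B}" by simp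
    note K(2)
    also have "limsup (\<lambda>n. ereal (1 / real n) *
        log_enat (approx_dim reduced_cstar (orbit_prod reduced_cstar \<beta> (translation ` K) n) (1 / 2)))
      \<le> Entp \<beta>"
      unfolding Entp_def product_entropy_over_def
      by (rule SUP_upper2[OF \<open>translation ` K \<in> _\<close>], rule SUP_upper2[of "1 / 2"]) auto
    finally show ?thesis .
  qed
  moreover have "(\<Sum>\<mu> | \<mu> \<in> eigenvalues (complex_matrix T) \<and> cmod \<mu> > 1.
      real (spectral_multiplicity \<mu> (complex_matrix T)) * ln (cmod \<mu>)) = ?h"
    by (rule eigenvalue_sum[OF charpoly_similar[OF rQ U]])
  ultimately show ?thesis by simp
qed

end

text \<open>The seminorm is infinite off the group algebra by definition and finite on it, since a
  translation changes the word length by a bounded amount. Both entropies thus range over the same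
  finite sets.\<close>

lemma Entp_seminorm_std_length:
  "Entp_seminorm (reduced_cstar :: ((int ^ 'd) ell2 \<Rightarrow>\<^sub>L (int ^ 'd) ell2) cstar)
    (length_seminorm std_length k) = Entp"
proof -
  have "{a \<in> cs_carrier (reduced_cstar :: ((int ^ 'd) ell2 \<Rightarrow>\<^sub>L (int ^ 'd) ell2) cstar). cs_norm reduced_cstar a \<le> 1 \<and> length_seminorm std_length k a < \<infinity>}
      = {a \<in> group_algebra. norm a \<le> 1}"
    using length_seminorm_finite[OF _ std_length_diff_bounded, of _ k]
      closure_subset[of "group_algebra :: ((int ^ 'd) ell2 \<Rightarrow>\<^sub>L (int ^ 'd) ell2) set"]
    by (auto simp: length_seminorm_def split: if_splits)
  then show ?thesis by (simp only: Entp_seminorm_def Entp_def)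
qed

theorem theorem3p5:
  fixes T :: "int ^ 'd ^ 'd"
    and \<alpha> :: "(complex ^ 'd \<Rightarrow> complex) \<Rightarrow> (complex ^ 'd \<Rightarrow> complex)"
    and \<Phi> :: "((int ^ 'd) ell2 \<Rightarrow>\<^sub>L (int ^ 'd) ell2) \<Rightarrow> (complex ^ 'd \<Rightarrow> complex)"
    and \<beta> :: "((int ^ 'd) ell2 \<Rightarrow>\<^sub>L (int ^ 'd) ell2) \<Rightarrow> ((int ^ 'd) ell2 \<Rightarrow>\<^sub>L (int ^ 'd) ell2)"
  assumes "invertible T"
    and "star_automorphism C_torus \<alpha>"
    and "\<And>x. \<alpha> (torus_char x) = torus_char (T *v x)"
    and "star_isomorphism reduced_cstar C_torus \<Phi>"
    and "\<And>x. \<Phi> (translation x) = torus_char x"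
    and "\<And>a. a \<in> cs_carrier reduced_cstar \<Longrightarrow>
           \<beta> a = the_inv_into (cs_carrier reduced_cstar) \<Phi> (\<alpha> (\<Phi> a))"
  shows "(\<forall>k > CARD('d). Entp_seminorm reduced_cstar (length_seminorm std_length k) \<beta> =
            ereal (\<Sum>\<mu> | \<mu> \<in> eigenvalues (complex_matrix T) \<and> cmod \<mu> > 1.
                     real (spectral_multiplicity \<mu> (complex_matrix T)) * ln (cmod \<mu>)))
       \<and> Entp \<beta> =
            ereal (\<Sum>\<mu> | \<mu> \<in> eigenvalues (complex_matrix T) \<and> cmod \<mu> > 1.
                     real (spectral_multiplicity \<mu> (complex_matrix T)) * ln (cmod \<mu>))"
proof -
  interpret torus_automorphism T \<alpha> \<Phi> \<beta>
    by unfold_locales (use assms in auto)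
  show ?thesis by (simp add: Entp_seminorm_std_length Entp_eq)
qed

end
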